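(* Let $G=\mathbb{FS}_{d,\ell}$ be the free solvable group of rank $d\ge 2$ and length $\ell\ge 3$. Then $G$ has a Schreier growth gap $\exp(n)$.
   Context: $\mathbb{FS}_{d,\ell}=F_d/F_d^{(\ell)}$, where $F_d$ is the free group of rank $d$ and $F_d^{(i)}$ is the derived series, defined by $F_d^{(1)}=[F_d,F_d]$ and $F_d^{(i+1)}=[F_d^{(i)},F_d^{(i)}]$. Let $G$ be a finitely generated group, $S$ a finite symmetric generating set, and $|\cdot|_S$ the word length. A $G$-set is a non-empty set with a $G$-action (not necessarily transitive); it is faithful if only the identity of $G$ acts trivially. The growth of the action of $G$ on a $G$-set $X$ is $\mathrm{vol}_{G,X}(n)=\max_{x\in X}|\{gx : g\in G,\ |g|_S\le n\}|$. For functions $f,g$ from $\mathbb{N}$ to the non-negative reals, $f(n)\preccurlyeq g(n)$ (equivalently $g(n)\succcurlyeq f(n)$) means that there is a constant $C>0$ such that $f(n)\le C g(Cn)$ for all sufficiently large $n$; $f\simeq g$ means $f\preccurlyeq g$ and $g\preccurlyeq f$. Up to $\simeq$, $\mathrm{vol}_{G,X}$ does not depend on $S$. The group $G$ has a Schreier growth gap $f(n)$ if every faithful $G$-set $X$ satisfies $\mathrm{vol}_{G,X}(n)\succcurlyeq f(n)$. *)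

theory Defs
  imports Complex_Main "HOL-Algebra.Algebra"
begin

section \<open>Free groups\<close>

text \<open>
  The free group on a set \<open>I\<close> consists of the freely reduced words over the letters
  \<open>(i, True)\<close> (standing for the generator \<open>i\<close>) and \<open>(i, False)\<close> (standing for its inverse).
\<close>

type_synonym 'i letter = "'i \<times> bool"

definition letter_inv :: "'i letter \<Rightarrow> 'i letter" where
  "letter_inv a = (fst a, \<not> snd a)"

definition reduced :: "'i letter list \<Rightarrow> bool" where
  "reduced w \<longleftrightarrow> successively (\<lambda>a b. b \<noteq> letter_inv a) w"

fun push_letter :: "'i letter \<Rightarrow> 'i letter list \<Rightarrow> 'i letter list" where
  "push_letter a [] = [a]"
| "push_letter a (b # w) = (if b = letter_inv a then w else a # b # w)"

definition free_group :: "'i set \<Rightarrow> 'i letter list monoid" where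
  "free_group I = \<lparr>carrier = {w \<in> lists (I \<times> UNIV). reduced w},
                   monoid.mult = foldr push_letter,
                   one = []\<rparr>"

lemma letter_inv_letter_inv [simp]: "letter_inv (letter_inv a) = a"
  by (simp add: letter_inv_def)

lemma letter_inv_mem [simp]: "letter_inv a \<in> I \<times> UNIV \<longleftrightarrow> a \<in> I \<times> UNIV"
  by (cases a) (simp add: letter_inv_def)

lemma reduced_Nil [simp]: "reduced []"
  by (simp add: reduced_def)

lemma reduced_Cons: "reduced (a # w) \<longleftrightarrow> reduced w \<and> (w = [] \<or> hd w \<noteq> letter_inv a)"
  by (cases w) (auto simp: reduced_def)

lemma reduced_push: "reduced w \<Longrightarrow> reduced (push_letter a w)"
  by (cases w) (auto simp: reduced_Cons)

lemma push_eq_Cons: "reduced (a # w) \<Longrightarrow> push_letter a w = a # w"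
  by (cases w) (auto simp: reduced_Cons)

lemma push_push_inv: "reduced w \<Longrightarrow> push_letter a (push_letter (letter_inv a) w) = w"
  by (cases w) (auto simp: push_eq_Cons)

lemma lists_push: "a \<in> A \<Longrightarrow> w \<in> lists A \<Longrightarrow> push_letter a w \<in> lists A"
  by (cases w) auto

lemma reduced_foldr_push: "reduced v \<Longrightarrow> reduced (foldr push_letter u v)"
  by (induction u) (auto intro: reduced_push)

lemma lists_foldr_push: "u \<in> lists A \<Longrightarrow> v \<in> lists A \<Longrightarrow> foldr push_letter u v \<in> lists A"
  by (induction u) (simp_all add: lists_push del: in_lists_conv_set)

lemma foldr_push_push:
  assumes "reduced u" "reduced w"
  shows "foldr push_letter (push_letter a u) w = push_letter a (foldr push_letter u w)"
  using assms push_push_inv[of "foldr push_letter (tl u) w" a]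
  by (cases u) (auto simp: reduced_Cons reduced_foldr_push)

lemma foldr_push_assoc:
  assumes "reduced u" "reduced v" "reduced w"
  shows "foldr push_letter (foldr push_letter u v) w = foldr push_letter u (foldr push_letter v w)"
  using assms by (induction u) (auto simp: foldr_push_push reduced_foldr_push reduced_Cons)

lemma foldr_push_Nil: "reduced u \<Longrightarrow> foldr push_letter u [] = u"
  by (induction u) (auto simp: push_eq_Cons reduced_Cons)

lemma foldr_push_left_inv:
  assumes "u \<in> lists A" "\<And>a. letter_inv a \<in> A \<longleftrightarrow> a \<in> A" "reduced u"
  shows "\<exists>v \<in> lists A. reduced v \<and> foldr push_letter v u = []"
  using assms(1,3)
proof (induction u)
  case Nil
  then show ?case by (intro bexI[of _ "[]"]) auto
next
  case (Cons a u)
  have a: "a \<in> A" using Cons.hyps by simp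
  from Cons obtain v where v: "v \<in> lists A" "reduced v" "foldr push_letter v u = []"
    by (auto simp: reduced_Cons)
  let ?v = "foldr push_letter v [letter_inv a]"
  have "foldr push_letter ?v (a # u) = foldr push_letter v (push_letter (letter_inv a) (a # u))"
    using Cons.prems v by (subst foldr_push_assoc) (auto simp: reduced_Cons)
  moreover have "?v \<in> lists A"
    using a v assms(2) by (intro lists_foldr_push) auto
  moreover have "reduced ?v"
    by (intro reduced_foldr_push) (simp add: reduced_Cons)
  ultimately show ?case
    using v(3) by (intro bexI[of _ ?v]) auto
qed

lemma group_free_group: "group (free_group I)"
proof (rule groupI, goal_cases)
  case (1 x y)
  then show ?case
    unfolding free_group_def
    by (simp add: reduced_foldr_push lists_foldr_push del: in_lists_conv_set)
next
  case (5 x)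
  then show ?case
    using foldr_push_left_inv[of x "I \<times> UNIV"] by (auto simp: free_group_def)
qed (auto simp: free_group_def foldr_push_assoc)

lemma free_group_generator_closed [simp]: "i \<in> I \<Longrightarrow> [(i, b)] \<in> carrier (free_group I)"
  by (simp add: free_group_def reduced_Cons)

lemma inv_free_group_generator:
  assumes "i \<in> I"
  shows "inv\<^bsub>free_group I\<^esub> [(i, b)] = [(i, \<not> b)]"
proof -
  interpret group "free_group I" by (rule group_free_group)
  show ?thesis
    using assms by (intro inv_equality) (auto simp: free_group_def reduced_Cons letter_inv_def)
qed

lemma free_group_Cons:
  assumes "a # w \<in> carrier (free_group I)"
  shows "a # w = [a] \<otimes>\<^bsub>free_group I\<^esub> w" "[a] \<in> carrier (free_group I)"
    "w \<in> carrier (free_group I)"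
  using assms by (auto simp: free_group_def push_eq_Cons reduced_Cons)

lemma generate_free_group:
  "generate (free_group I) ((\<lambda>i. [(i, True)]) ` I) = carrier (free_group I)"
proof -
  interpret group "free_group I" by (rule group_free_group)
  let ?S = "(\<lambda>i. [(i, True)]) ` I"
  have letter: "[(i, b)] \<in> generate (free_group I) ?S" if "i \<in> I" for i b
    using that inv_free_group_generator[of i I True] generate.incl[of "[(i, True)]" ?S]
      generate.inv[of "[(i, True)]" ?S "free_group I"]
    by (cases b) auto
  have "w \<in> generate (free_group I) ?S" if "w \<in> carrier (free_group I)" for w
    using that
  proof (induction w)
    case Nil
    show ?case using generate.one[of "free_group I" ?S] by (simp add: free_group_def)
  next
    case (Cons a w)
    have "fst a \<in> I" using Cons.prems by (auto simp: free_group_def)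
    then have "[a] \<in> generate (free_group I) ?S" using letter[of "fst a" "snd a"] by simp
    then show ?case
      using Cons free_group_Cons[OF Cons.prems] by (metis generate.eng)
  qed
  moreover have "generate (free_group I) ?S \<subseteq> carrier (free_group I)"
    by (intro generate_incl) auto
  ultimately show ?thesis by blast
qed

text \<open>The universal property of the free group on \<open>I\<close>.\<close>

lemma free_group_universal:
  assumes "group H" and f: "f \<in> I \<rightarrow> carrier H"
  shows "\<exists>h \<in> hom (free_group I) H. \<forall>i\<in>I. h [(i, True)] = f i"
    and "\<lbrakk>h \<in> hom (free_group I) H; h' \<in> hom (free_group I) H; \<forall>i\<in>I. h [(i, True)] = h' [(i, True)];
          w \<in> carrier (free_group I)\<rbrakk> \<Longrightarrow> h w = h' w"
proof -
  interpret H: group H by fact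
  interpret F: group "free_group I" by (rule group_free_group)
  define e where "e = (\<lambda>a. if snd a then f (fst a) else inv\<^bsub>H\<^esub> f (fst a))"
  define h where "h = (\<lambda>w. foldr (\<lambda>a x. e a \<otimes>\<^bsub>H\<^esub> x) w \<one>\<^bsub>H\<^esub>)"
  let ?A = "I \<times> (UNIV :: bool set)"
  have e: "e a \<in> carrier H" if "a \<in> ?A" for a
    using that f by (auto simp: e_def)
  have e_inv: "e (letter_inv a) = inv\<^bsub>H\<^esub> e a" if "a \<in> ?A" for a
    using that f by (cases "snd a") (auto simp: e_def letter_inv_def Pi_iff)
  have h_Nil: "h [] = \<one>\<^bsub>H\<^esub>" and h_Cons: "h (a # w) = e a \<otimes>\<^bsub>H\<^esub> h w" for a w
    by (simp_all add: h_def)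
  have h: "h w \<in> carrier H" if "w \<in> lists ?A" for w
    using that by (induction w) (auto simp: h_Nil h_Cons e simp del: in_lists_conv_set)
  have push: "h (push_letter a w) = e a \<otimes>\<^bsub>H\<^esub> h w" if "a \<in> ?A" "w \<in> lists ?A" for a w
  proof (cases w)
    case (Cons b v)
    have v: "h v \<in> carrier H" using that Cons by (intro h) auto
    then show ?thesis using Cons e[OF that(1)] e_inv[OF that(1)]
      by (simp add: h_Cons H.m_assoc [symmetric])
  qed (simp add: h_Nil h_Cons)
  have mult: "h (foldr push_letter u w) = h u \<otimes>\<^bsub>H\<^esub> h w"
    if "u \<in> lists ?A" "w \<in> lists ?A" for u w
    using that
    by (induction u)
      (auto simp: h_Nil h_Cons push h e lists_foldr_push H.m_assoc simp del: in_lists_conv_set)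
  have "h \<in> hom (free_group I) H"
    by (intro homI) (auto simp: free_group_def h mult simp del: in_lists_conv_set)
  moreover have "h [(i, True)] = f i" if "i \<in> I" for i
    using that f by (simp add: h_Nil h_Cons e_def Pi_iff)
  ultimately show "\<exists>h \<in> hom (free_group I) H. \<forall>i\<in>I. h [(i, True)] = f i" by blast
next
  assume hom: "h \<in> hom (free_group I) H" "h' \<in> hom (free_group I) H"
    and eq: "\<forall>i\<in>I. h [(i, True)] = h' [(i, True)]" and "w \<in> carrier (free_group I)"
  interpret h: group_hom "free_group I" H h
    using hom assms(1) by (simp add: group_hom_def group_hom_axioms_def group_free_group)
  interpret h': group_hom "free_group I" H h'
    using hom assms(1) by (simp add: group_hom_def group_hom_axioms_def group_free_group)
  have "w \<in> generate (free_group I) ((\<lambda>i. [(i, True)]) ` I)"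
    using \<open>w \<in> carrier _\<close> generate_free_group by blast
  then show "h w = h' w"
  proof induction
    case (eng u v)
    moreover from eng have "u \<in> carrier (free_group I)" "v \<in> carrier (free_group I)"
      using generate_free_group by blast+
    ultimately show ?case by simp
  qed (use eq in auto)
qed

section \<open>Free solvable groups\<close>

definition free_solvable_group :: "nat \<Rightarrow> nat \<Rightarrow> nat letter list set monoid" where
  "free_solvable_group d l =
     (let F = free_group {..<d} in F Mod ((derived F ^^ l) (carrier F)))"

section \<open>Word length and growth of actions\<close>

definition finite_symmetric_generating_set :: "('a, 'b) monoid_scheme \<Rightarrow> 'a set \<Rightarrow> bool" where
  "finite_symmetric_generating_set G S \<longleftrightarrow>
     finite S \<and> S \<subseteq> carrier G \<and> (\<forall>s\<in>S. inv\<^bsub>G\<^esub> s \<in> S) \<and> generate G S = carrier G"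

definition word_length :: "('a, 'b) monoid_scheme \<Rightarrow> 'a set \<Rightarrow> 'a \<Rightarrow> nat" where
  "word_length G S g =
     (LEAST n. \<exists>ws \<in> lists S. length ws = n \<and> foldr (\<otimes>\<^bsub>G\<^esub>) ws \<one>\<^bsub>G\<^esub> = g)"

definition action_growth ::
  "('a, 'b) monoid_scheme \<Rightarrow> 'a set \<Rightarrow> 'x set \<Rightarrow> ('a \<Rightarrow> 'x \<Rightarrow> 'x) \<Rightarrow> nat \<Rightarrow> nat" where
  "action_growth G S E act n =
     (MAX x\<in>E. card {act g x | g. g \<in> carrier G \<and> word_length G S g \<le> n})"

definition growth_le :: "(nat \<Rightarrow> real) \<Rightarrow> (nat \<Rightarrow> real) \<Rightarrow> bool" (infix "\<preceq>\<^sub>g" 50) where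
  "f \<preceq>\<^sub>g h \<longleftrightarrow> (\<exists>C::nat. C > 0 \<and> (\<forall>\<^sub>F n in sequentially. f n \<le> real C * h (C * n)))"

lemma exp_of_derived_normal: "group G \<Longrightarrow> (derived G ^^ n) (carrier G) \<lhd> G"
  by (induction n) (auto intro: group.derived_is_normal group.normal_self)

lemma group_free_solvable_group: "group (free_solvable_group d l)"
  unfolding free_solvable_group_def Let_def
  by (intro normal.factorgroup_is_group exp_of_derived_normal group_free_group)

lemma finite_symmetric_generating_set_free_solvable_group:
  "\<exists>S. finite_symmetric_generating_set (free_solvable_group d l) S"
proof -
  define F where "F = free_group {..<d}"
  define N where "N = (derived F ^^ l) (carrier F)"
  define S where "S = (\<lambda>(i, b). [(i, b)]) ` ({..<d} \<times> (UNIV :: bool set))"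
  define h where "h = (\<lambda>w. N #>\<^bsub>F\<^esub> w)"
  interpret F: group F unfolding F_def by (rule group_free_group)
  interpret N: normal N F unfolding N_def by (intro exp_of_derived_normal F.is_group)
  have Q: "free_solvable_group d l = F Mod N"
    by (simp add: free_solvable_group_def F_def N_def Let_def)
  interpret h: group_hom F "F Mod N" h
    unfolding group_hom_def group_hom_axioms_def h_def
    using N.r_coset_hom_Mod N.factorgroup_is_group F.is_group by blast
  have S: "S \<subseteq> carrier F" unfolding S_def F_def by auto
  have "(\<lambda>i. [(i, True)]) ` {..<d} \<subseteq> S" by (auto simp: S_def)
  then have "carrier F \<subseteq> generate F S"
    using F.mono_generate generate_free_group[of "{..<d}"] unfolding F_def by metis
  moreover have "generate F S \<subseteq> carrier F" using S by (rule F.generate_incl)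
  ultimately have gen: "generate F S = carrier F" by blast
  have inv: "inv\<^bsub>F\<^esub> s \<in> S" if "s \<in> S" for s
    using that by (auto simp: S_def F_def inv_free_group_generator)
  have "generate (F Mod N) (h ` S) = carrier (F Mod N)"
    using h.generate_img[OF S] gen by (simp add: carrier_FactGroup h_def)
  moreover have "inv\<^bsub>F Mod N\<^esub> t \<in> h ` S" if "t \<in> h ` S" for t
  proof -
    from that obtain s where s: "s \<in> S" "t = h s" by blast
    then have "inv\<^bsub>F Mod N\<^esub> t = h (inv\<^bsub>F\<^esub> s)" using S by (simp add: subsetD)
    then show ?thesis using inv s(1) by blast
  qed
  moreover have "h ` S \<subseteq> carrier (F Mod N)" using S by auto
  moreover have "finite (h ` S)" by (simp add: S_def)
  ultimately have "finite_symmetric_generating_set (F Mod N) (h ` S)"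
    by (simp add: finite_symmetric_generating_set_def)
  then show ?thesis unfolding Q by blast
qed

text \<open>
  A definition cannot quantify over the type of the points of a \<open>G\<close>-set, so this type is made an
  explicit parameter; the unrestricted notion is obtained by leaving \<open>'x\<close> a type variable.
  A finitely generated group is required, so that quantifying over all finite symmetric
  generating sets is never vacuous.
\<close>

definition schreier_growth_gap ::
  "'x itself \<Rightarrow> ('a, 'b) monoid_scheme \<Rightarrow> (nat \<Rightarrow> real) \<Rightarrow> bool" where
  "schreier_growth_gap _ G f \<longleftrightarrow>
     group G \<and> (\<exists>S. finite_symmetric_generating_set G S) \<and>
     (\<forall>S. finite_symmetric_generating_set G S \<longrightarrow>
        (\<forall>(E :: 'x set) act. E \<noteq> {} \<and> faithful_action G E act \<longrightarrow>
           f \<preceq>\<^sub>g (\<lambda>n. real (action_growth G S E act n))))"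

end

theory Submission
  imports Defs
begin

text \<open>
  Let \<open>K\<close>, \<open>N\<close>, \<open>L\<close> be the terms \<open>l - 2\<close>, \<open>l - 1\<close>, \<open>l\<close> of the derived series of the free group
  \<open>F\<close>. A word in a normal subgroup \<open>N\<close> is a closed path in the Cayley graph of \<open>F/N\<close>, and counting its
  signed passages through the edges is a Fox derivative: an equivariant homomorphism from \<open>N/[N,N]\<close>
  to a free module over the group ring of \<open>F/N\<close>. It is nonzero, since a shortest nontrivial word of
  \<open>N\<close> is a simple closed path.

  Let \<open>x\<close> be a generator and \<open>u \<in> K\<close> of nonzero flow. The \<open>2^n\<close> products of \<open>n\<close> factors from
  \<open>{x, x u}\<close> differ pairwise by elements of \<open>K\<close> of infinite order modulo \<open>N\<close>; let \<open>P\<close> be the set of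
  these differences. If in a faithful action of \<open>F/L\<close> every point were fixed by some \<open>p \<in> P\<close>, then
  applying Neumann's lemma to the abelian normal subgroup \<open>N/L\<close>, on which the elements of \<open>K\<close>
  act by commuting automorphisms, a nonzero multiple of \<open>\<Prod>p\<in>P. (p - 1)\<close> would send \<open>N/L\<close> into all
  point stabilisers, hence to zero. As the \<open>p\<close> have infinite order, \<open>p - 1\<close> is not a zero divisor
  of the group ring, a contradiction. So some point is moved by all of \<open>P\<close>, which means that the
  \<open>2^n\<close> products take it to \<open>2^n\<close> different points.
\<close>

section \<open>Flows on Cayley graphs\<close>

lemma (in group) cancel_inv [simp]:
  assumes "x \<in> carrier G" "y \<in> carrier G"
  shows "x \<otimes> (inv x \<otimes> y) = y" "inv x \<otimes> (x \<otimes> y) = y"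
  using assms by (simp_all flip: m_assoc)

lemma fst_letter_inv [simp]: "fst (letter_inv b) = fst b"
  by (simp add: letter_inv_def)

lemma letter_inv_neq: "letter_inv b \<noteq> b"
  by (metis letter_inv_def snd_conv)

lemma letter_inv_eq_iff: "letter_inv a = letter_inv b \<longleftrightarrow> a = b"
  by (metis letter_inv_letter_inv)

text \<open>
  \<open>flow N a w g\<close> is the signed number of times the path labelled \<open>w\<close> from the base point of the
  Cayley graph of the free group modulo \<open>N\<close> passes the edge labelled \<open>a\<close> that starts at the coset of \<open>g\<close>.
\<close>

fun flow :: "'i letter list set \<Rightarrow> 'i letter \<Rightarrow> 'i letter list \<Rightarrow> 'i letter list \<Rightarrow> int" where
  "flow N a [] g = 0"
| "flow N a (b # w) g =
     of_bool (b = a \<and> g \<in> N) - of_bool (b = letter_inv a \<and> foldr push_letter g [a] \<in> N)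
     + flow N a w (push_letter (letter_inv b) g)"

locale free_group_normal = normal N F for N and F :: "'i letter list monoid" (structure) +
  fixes I :: "'i set"
  assumes free: "F = free_group I"
begin

lemma carrier_free: "carrier F = {w \<in> lists (I \<times> UNIV). reduced w}"
  and mult_free: "x \<otimes> y = foldr push_letter x y"
  and one_free: "\<one> = []"
  by (simp_all add: free free_group_def)

lemma letter_carrier: "[b] \<in> carrier F \<longleftrightarrow> fst b \<in> I"
  by (cases b) (auto simp: carrier_free reduced_Cons)

lemma inv_letter: "fst b \<in> I \<Longrightarrow> inv [b] = [letter_inv b]"
  using inv_free_group_generator[of "fst b" I "snd b"] by (simp add: free letter_inv_def)

lemma Cons_carrier:
  assumes "b # w \<in> carrier F"
  shows "b # w = [b] \<otimes> w" "fst b \<in> I" "w \<in> carrier F" "[b] \<in> carrier F"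
  using free_group_Cons[of b w I] assms letter_carrier[of b] unfolding free by auto

text \<open>After reading \<open>b\<close>, the path is translated back to the base point, which
  moves the observed edge to \<open>inv [b] \<otimes> g\<close>. A backward passage starts at the
  end of the edge, hence the test on \<open>g \<otimes> [a]\<close>.\<close>

lemma flow_Cons:
  assumes "fst b \<in> I"
  shows "flow N a (b # w) g =
     of_bool (b = a \<and> g \<in> N) - of_bool (b = letter_inv a \<and> g \<otimes> [a] \<in> N) + flow N a w (inv [b] \<otimes> g)"
  using assms by (simp add: inv_letter mult_free)

declare flow.simps(2) [simp del]

lemma mem_conj_iff:
  assumes "x \<in> carrier F" "y \<in> carrier F"
  shows "x \<otimes> y \<in> N \<longleftrightarrow> y \<otimes> x \<in> N"
proof -
  have *: "y \<otimes> x \<in> N" if "x \<otimes> y \<in> N" "x \<in> carrier F" "y \<in> carrier F" for x y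
  proof -
    have "inv x \<otimes> (x \<otimes> y) \<otimes> x \<in> N" using inv_op_closed1[of x "x \<otimes> y"] that by auto
    then show ?thesis using that by (simp add: m_assoc[symmetric])
  qed
  show ?thesis using *[of x y] *[of y x] assms by blast
qed

lemma mem_mult_iff:
  assumes "n \<in> N" "x \<in> carrier F"
  shows "n \<otimes> x \<in> N \<longleftrightarrow> x \<in> N"
proof
  assume "n \<otimes> x \<in> N"
  moreover have "inv n \<in> N" using assms by simp
  ultimately have "inv n \<otimes> (n \<otimes> x) \<in> N" by (rule subgroup.m_closed[OF is_subgroup, rotated])
  then show "x \<in> N" using assms by (metis cancel_inv(2) mem_carrier)
qed (use assms in auto)

lemma flow_letter_mult:
  assumes w: "w \<in> carrier F" and b: "fst b \<in> I" and a: "fst a \<in> I" and g: "g \<in> carrier F"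
  shows "flow N a ([b] \<otimes> w) g = flow N a [b] g + flow N a w (inv [b] \<otimes> g)"
proof (cases "\<exists>w'. w = letter_inv b # w'")
  case False
  then have "[b] \<otimes> w = b # w" by (cases w) (auto simp: mult_free)
  then show ?thesis using b by (simp add: flow_Cons)
next
  case True
  then obtain w' where w': "w = letter_inv b # w'" by blast
  have A: "[a] \<in> carrier F" and B: "[b] \<in> carrier F" using a b by (auto simp: letter_carrier)
  have "[b] \<otimes> w = w'" using w' by (auto simp: mult_free)
  moreover have "inv [letter_inv b] = [b]" using b by (simp add: inv_letter)
  moreover have "flow N a w (inv [b] \<otimes> g) = flow N a [letter_inv b] (inv [b] \<otimes> g) + flow N a w' g"
    using b B g unfolding w' by (simp add: flow_Cons \<open>inv [letter_inv b] = [b]\<close> m_assoc[symmetric])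
  \<comment> \<open>The letters \<open>b\<close> and \<open>letter_inv b\<close> pass the same edge
    in opposite directions, so free cancellation does not change the flow.\<close>
  moreover have "flow N a [b] g + flow N a [letter_inv b] (inv [b] \<otimes> g) = 0"
  proof -
    have 1: "(b = a \<and> g \<in> N) \<longleftrightarrow> (letter_inv b = letter_inv a \<and> inv [b] \<otimes> g \<otimes> [a] \<in> N)"
    proof (cases "b = a")
      case True
      then show ?thesis using A g mem_conj_iff[of "inv [a] \<otimes> g" "[a]"]
        by (simp add: m_assoc[symmetric])
    qed (simp add: letter_inv_eq_iff)
    have 2: "(b = letter_inv a \<and> g \<otimes> [a] \<in> N) \<longleftrightarrow> (letter_inv b = a \<and> inv [b] \<otimes> g \<in> N)"
    proof (cases "b = letter_inv a")
      case True
      then show ?thesis using A g a mem_conj_iff[of g "[a]"]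
        by (simp add: inv_letter)
    next
      case False
      then show ?thesis by auto
    qed
    show ?thesis using b 1 2 by (simp add: flow_Cons)
  qed
  ultimately show ?thesis by simp
qed

section \<open>Product rule, equivariance and vanishing on the derived subgroup\<close>

context
  fixes a :: "'i letter" assumes a: "fst a \<in> I"
begin

lemma a_carrier: "[a] \<in> carrier F"
  using a by (simp add: letter_carrier)

lemma flow_one [simp]: "flow N a \<one> g = 0"
  by (simp add: one_free)

text \<open>The product rule of the Fox derivative: \<open>w\<close> is read from the end of
  \<open>u\<close>, which shifts the observed edge by \<open>inv u\<close>.\<close>

lemma flow_mult:
  assumes "u \<in> carrier F" "w \<in> carrier F" "g \<in> carrier F"
  shows "flow N a (u \<otimes> w) g = flow N a u g + flow N a w (inv u \<otimes> g)"
  using assms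
proof (induction u arbitrary: g)
  case Nil
  then show ?case by (simp flip: one_free)
next
  case (Cons b u)
  note b = Cons_carrier[OF Cons.prems(1)]
  have "flow N a ((b # u) \<otimes> w) g = flow N a ([b] \<otimes> (u \<otimes> w)) g"
    using b Cons.prems by (simp add: m_assoc)
  also have "\<dots> = flow N a [b] g + flow N a (u \<otimes> w) (inv [b] \<otimes> g)"
    using b Cons.prems a by (intro flow_letter_mult) auto
  also have "\<dots> = flow N a [b] g + flow N a u (inv [b] \<otimes> g) + flow N a w (inv (b # u) \<otimes> g)"
    using b Cons.prems Cons.IH[of "inv [b] \<otimes> g"] unfolding b(1)
    by (simp add: inv_mult_group m_assoc)
  also have "flow N a [b] g + flow N a u (inv [b] \<otimes> g) = flow N a (b # u) g"
    unfolding b(1) using b(2-4) Cons.prems a by (intro flow_letter_mult[symmetric]) auto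
  finally show ?case .
qed

text \<open>Moving past a letter \<open>b\<close> conjugates \<open>n\<close> by \<open>[b]\<close>,
  which stays in \<open>N\<close> by normality; so the induction varies \<open>n\<close> together
  with \<open>g\<close>.\<close>

lemma flow_translate:
  assumes "w \<in> carrier F" "g \<in> carrier F" "n \<in> N"
  shows "flow N a w (n \<otimes> g) = flow N a w g"
  using assms
proof (induction w arbitrary: g n)
  case (Cons b w)
  note b = Cons_carrier[OF Cons.prems(1)]
  have n: "n \<in> carrier F" using Cons.prems by auto
  have "inv [b] \<otimes> (n \<otimes> g) = (inv [b] \<otimes> n \<otimes> [b]) \<otimes> (inv [b] \<otimes> g)"
    using b n Cons.prems by (simp add: m_assoc)
  moreover have "inv [b] \<otimes> n \<otimes> [b] \<in> N"
    using inv_op_closed1[of "[b]" n] b Cons.prems by simp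
  ultimately have "flow N a w (inv [b] \<otimes> (n \<otimes> g)) = flow N a w (inv [b] \<otimes> g)"
    using Cons b by simp
  moreover have "n \<otimes> g \<otimes> [a] \<in> N \<longleftrightarrow> g \<otimes> [a] \<in> N"
    using Cons.prems n a_carrier mem_mult_iff[of n "g \<otimes> [a]"] by (simp add: m_assoc)
  ultimately show ?case
    using b(2) Cons.prems mem_mult_iff[of n g] by (simp add: flow_Cons)
qed simp

lemma flow_mult_mem:
  assumes "u \<in> N" "w \<in> carrier F" "g \<in> carrier F"
  shows "flow N a (u \<otimes> w) g = flow N a u g + flow N a w g"
  using flow_mult[of u w g] flow_translate[of w g "inv u"] assms by auto

lemma flow_inv_mem:
  assumes "u \<in> N" "g \<in> carrier F"
  shows "flow N a (inv u) g = - flow N a u g"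
  using flow_mult_mem[of u "inv u" g] assms by auto

text \<open>The path of \<open>u\<close> closes up modulo \<open>N\<close>, so the contributions of
  the way out along \<open>p\<close> and the way back along \<open>inv p\<close> cancel.\<close>

lemma flow_conj:
  assumes "p \<in> carrier F" "u \<in> N" "g \<in> carrier F"
  shows "flow N a (p \<otimes> u \<otimes> inv p) g = flow N a u (inv p \<otimes> g)"
proof -
  have u: "u \<in> carrier F" using assms by auto
  have "flow N a (p \<otimes> u \<otimes> inv p) g = flow N a (p \<otimes> (u \<otimes> inv p)) g"
    using assms u by (simp add: m_assoc)
  also have "\<dots> = flow N a p g + (flow N a u (inv p \<otimes> g) + flow N a (inv p) (inv p \<otimes> g))"
    using assms u flow_translate[of "inv p" "inv p \<otimes> g" "inv u"] by (simp add: flow_mult)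
  also have "\<dots> = flow N a u (inv p \<otimes> g)"
    using flow_mult[of p "inv p" g] assms by simp
  finally show ?thesis .
qed

lemma flow_commutator:
  assumes "p \<in> carrier F" "u \<in> N" "g \<in> carrier F"
  shows "flow N a (p \<otimes> u \<otimes> inv p \<otimes> inv u) g = flow N a u (inv p \<otimes> g) - flow N a u g"
  using assms flow_mult_mem[of "p \<otimes> u \<otimes> inv p" "inv u" g] flow_conj[of p u g] flow_inv_mem[of u g]
    inv_op_closed2[of p u] by auto

lemma flow_pow:
  assumes "u \<in> N" "g \<in> carrier F"
  shows "flow N a (u [^] (k::nat)) g = int k * flow N a u g"
proof (induction k)
  case (Suc k)
  have "u [^] k \<in> N" using assms(1) by (induction k) auto
  then show ?case using assms Suc by (auto simp: flow_mult_mem algebra_simps)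
qed simp

text \<open>On \<open>N\<close> the flow is additive and invariant under conjugation by
  \<open>N\<close>, so commutators have zero flow.\<close>

lemma flow_derived:
  assumes "w \<in> derived F N" "g \<in> carrier F"
  shows "flow N a w g = 0"
  using assms(1) unfolding derived_def
proof (induction rule: generate.induct)
  case (incl h)
  then show ?case using assms(2) flow_commutator flow_translate by (auto simp: subset)
next
  case (inv h)
  then obtain x y where xy: "x \<in> N" "y \<in> N" "h = x \<otimes> y \<otimes> inv x \<otimes> inv y" by auto
  then have "h \<in> N" by auto
  moreover have "flow N a h g = 0"
    using xy assms(2) flow_commutator[of x y g] flow_translate[of y g "inv x"] by (auto simp: subset)
  ultimately show ?case using flow_inv_mem[of h g] assms(2) by simp
next
  case (eng h k)
  have "generate F (derived_set F N) \<subseteq> N"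
    using derived_incl[OF subset_refl is_subgroup] by (simp add: derived_def)
  then have "h \<in> N" "k \<in> N" using eng by auto
  then show ?case using eng assms(2) flow_mult_mem[of h k g] by simp
qed simp

lemma pow_notin_derived:
  assumes "u \<in> N" "g \<in> carrier F" "flow N a u g \<noteq> 0" "k > 0"
  shows "u [^] (k::nat) \<notin> derived F N"
  using assms flow_derived[of "u [^] k" g] flow_pow[of u g k] by auto

section \<open>Finiteness of the support and elements of infinite order\<close>

lemma finite_flow_support:
  assumes "w \<in> carrier F"
  shows "finite {N #> g | g. g \<in> carrier F \<and> flow N a w g \<noteq> 0}"
  using assms
proof (induction w)
  case (Cons b w)
  note b = Cons_carrier[OF Cons.prems]
  let ?T = "{N #> g | g. g \<in> carrier F \<and> flow N a w g \<noteq> 0}"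
  \<comment> \<open>The first letter contributes only at \<open>N\<close> and
    \<open>N #> inv [a]\<close>; the rest of the path contributes the support of \<open>w\<close>
    translated by \<open>[b]\<close>.\<close>
  have "{N #> g | g. g \<in> carrier F \<and> flow N a (b # w) g \<noteq> 0} \<subseteq> {N, N #> inv [a]} \<union> l_coset F [b] ` ?T"
  proof (rule subsetI, rule ccontr)
    fix C assume "C \<in> {N #> g | g. g \<in> carrier F \<and> flow N a (b # w) g \<noteq> 0}"
      and C: "C \<notin> {N, N #> inv [a]} \<union> l_coset F [b] ` ?T"
    then obtain g where g: "g \<in> carrier F" "flow N a (b # w) g \<noteq> 0" and Cg: "C = N #> g"
      by blast
    have "N #> g \<in> l_coset F [b] ` ?T" if nz: "flow N a w (inv [b] \<otimes> g) \<noteq> 0"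
    proof -
      have "l_coset F [b] (N #> (inv [b] \<otimes> g)) = l_coset F [b] (l_coset F (inv [b] \<otimes> g) N)"
        using g b coset_eq by simp
      also have "\<dots> = l_coset F g N" using g b by (simp add: lcos_m_assoc subset m_assoc[symmetric])
      also have "\<dots> = N #> g" using g coset_eq by simp
      finally show ?thesis using nz g b(2-4) by (intro image_eqI) auto
    qed
    then have "flow N a w (inv [b] \<otimes> g) = 0" using C Cg by blast
    moreover have "g \<otimes> [a] \<notin> N"
    proof
      assume "g \<otimes> [a] \<in> N"
      then have "N #> (g \<otimes> [a] \<otimes> inv [a]) = N #> inv [a]"
        using a_carrier g(1) coset_mult_assoc[OF subset, of "g \<otimes> [a]" "inv [a]"] rcos_const[of "g \<otimes> [a]"]
        by (simp add: coset_join2 is_subgroup)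
      then show False using a_carrier g C Cg by (simp add: m_assoc)
    qed
    ultimately have "g \<in> N" using g(2) b(2) by (auto simp: flow_Cons split: if_splits)
    then show False using g(1) C Cg by (simp add: coset_join2 is_subgroup)
  qed
  moreover have "finite ?T" using Cons b by simp
  ultimately show ?case by (meson finite_Un finite_imageI finite_insert finite.emptyI finite_subset)
qed simp

text \<open>Different powers of \<open>p\<close> lie over different cosets, and only finitely many
  cosets carry flow.\<close>

lemma finite_flow_orbit:
  assumes "w \<in> carrier F" "p \<in> carrier F" "g \<in> carrier F" "\<And>k. k > 0 \<Longrightarrow> p [^] (k::nat) \<notin> N"
  shows "finite {k::nat. flow N a w (p [^] k \<otimes> g) \<noteq> 0}"
proof (rule finite_imageD)
  show "finite ((\<lambda>k::nat. N #> (p [^] k \<otimes> g)) ` {k. flow N a w (p [^] k \<otimes> g) \<noteq> 0})"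
  proof (rule finite_subset[OF image_subsetI finite_flow_support[OF assms(1)]])
    fix k :: nat assume "k \<in> {k. flow N a w (p [^] k \<otimes> g) \<noteq> 0}"
    then show "N #> (p [^] k \<otimes> g) \<in> {N #> g | g. g \<in> carrier F \<and> flow N a w g \<noteq> 0}"
      using assms by auto
  qed
  have neq: "N #> (p [^] i \<otimes> g) \<noteq> N #> (p [^] j \<otimes> g)" if "i < j" for i j :: nat
  proof
    assume "N #> (p [^] i \<otimes> g) = N #> (p [^] j \<otimes> g)"
    then have "p [^] j \<otimes> g \<in> N #> (p [^] i \<otimes> g)"
      using assms by (metis is_subgroup m_closed nat_pow_closed rcos_self)
    then have "p [^] j \<otimes> g \<otimes> inv (p [^] i \<otimes> g) \<in> N"
      using assms by (simp add: rcos_module)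
    moreover have "p [^] j \<otimes> g \<otimes> inv (p [^] i \<otimes> g) = p [^] (j - i)"
    proof -
      have "p [^] j = p [^] (j - i) \<otimes> p [^] i" using assms that by (simp add: nat_pow_mult)
      then show ?thesis using assms by (simp add: inv_mult_group m_assoc)
    qed
    ultimately show False using assms(4)[of "j - i"] that by simp
  qed
  show "inj_on (\<lambda>k::nat. N #> (p [^] k \<otimes> g)) {k. flow N a w (p [^] k \<otimes> g) \<noteq> 0}"
    by (rule linorder_inj_onI') (use neq in blast)
qed

text \<open>The commutator multiplies the flow of \<open>u\<close> by the group ring element
  \<open>p - 1\<close>. If the result vanished, the flow of \<open>u\<close> would be constant along
  the translates of \<open>g\<close> by powers of \<open>p\<close>, against
  \<open>finite_flow_orbit\<close>.\<close>

lemma flow_commutator_nonzero: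
  assumes "p \<in> carrier F" "\<And>k. k > 0 \<Longrightarrow> p [^] (k::nat) \<notin> N" "u \<in> N" "g \<in> carrier F"
    and nz: "flow N a u g \<noteq> 0"
  shows "\<exists>g \<in> carrier F. flow N a (p \<otimes> u \<otimes> inv p \<otimes> inv u) g \<noteq> 0"
proof (rule ccontr)
  assume "\<not> ?thesis"
  then have step: "flow N a u (inv p \<otimes> g) = flow N a u g" if "g \<in> carrier F" for g
    using flow_commutator assms that by force
  have "flow N a u (p [^] k \<otimes> g) = flow N a u g" for k :: nat
  proof (induction k)
    case (Suc k)
    have "inv p \<otimes> (p [^] Suc k \<otimes> g) = p [^] k \<otimes> g"
      using assms by (subst nat_pow_Suc2) (auto simp: m_assoc[symmetric])
    then show ?case using step[of "p [^] Suc k \<otimes> g"] Suc assms by simp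
  qed (use assms in simp)
  then have "{k::nat. flow N a u (p [^] k \<otimes> g) \<noteq> 0} = UNIV" using nz by simp
  moreover have "finite {k::nat. flow N a u (p [^] k \<otimes> g) \<noteq> 0}"
    using assms by (intro finite_flow_orbit) auto
  ultimately show False by simp
qed

end

end

section \<open>Exponentially many words with distinct flows\<close>

text \<open>The head of the list governs the last factor. Thus, when two lists are extended, the
  quotient \<open>inv s \<otimes> t\<close> of their products is conjugated by \<open>inv x\<close>
  and multiplied by powers of \<open>u\<close> on the outside.\<close>

primrec branch :: "('a, 'b) monoid_scheme \<Rightarrow> 'a \<Rightarrow> 'a \<Rightarrow> bool list \<Rightarrow> 'a" where
  "branch G u x [] = \<one>\<^bsub>G\<^esub>"
| "branch G u x (b # bs) = branch G u x bs \<otimes>\<^bsub>G\<^esub> (x \<otimes>\<^bsub>G\<^esub> (if b then u else \<one>\<^bsub>G\<^esub>))"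

lemma (in group) branch_closed [simp]:
  "\<lbrakk>u \<in> carrier G; x \<in> carrier G\<rbrakk> \<Longrightarrow> branch G u x bs \<in> carrier G"
  by (induction bs) auto

lemma (in group_hom) hom_branch:
  "\<lbrakk>u \<in> carrier G; x \<in> carrier G\<rbrakk> \<Longrightarrow> h (branch G u x bs) = branch H (h u) (h x) bs"
  by (induction bs) auto

context free_group_normal
begin

lemma append_carrier:
  assumes "u @ v \<in> carrier F"
  shows "u \<in> carrier F" "v \<in> carrier F" "u @ v = u \<otimes> v"
proof -
  show *: "u \<in> carrier F" "v \<in> carrier F"
    using assms by (auto simp: carrier_free reduced_def successively_append_iff)
  have "u @ v = u \<otimes> v" if "u @ v \<in> carrier F" for u
    using that
  proof (induction u)
    case Nil
    then show ?case by (simp add: mult_free)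
  next
    case (Cons b u)
    have "(b # u) \<otimes> v = push_letter b (u \<otimes> v)" by (simp add: mult_free)
    also have "\<dots> = push_letter b (u @ v)" using Cons Cons_carrier[of b "u @ v"] by simp
    also have "\<dots> = (b # u) @ v" using Cons.prems by (simp add: push_eq_Cons carrier_free)
    finally show ?case by simp
  qed
  then show "u @ v = u \<otimes> v" using assms by blast
qed

text \<open>Each summand of the flow comes from one letter, so a nonzero sum exhibits a prefix
  \<open>v\<close> after which the edge is passed forwards or backwards.\<close>

lemma flow_nonzero_split:
  assumes "fst a \<in> I" "w \<in> carrier F" "g \<in> carrier F" "flow N a w g \<noteq> 0"
  shows "\<exists>v b v'. w = v @ b # v' \<and>
    (b = a \<and> inv v \<otimes> g \<in> N \<or> b = letter_inv a \<and> inv v \<otimes> g \<otimes> [a] \<in> N)"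
  using assms(2-4)
proof (induction w arbitrary: g)
  case (Cons b w)
  note b = Cons_carrier[OF Cons.prems(1)]
  show ?case
  proof (cases "b = a \<and> g \<in> N \<or> b = letter_inv a \<and> g \<otimes> [a] \<in> N")
    case True
    then have "inv [] \<otimes> g = g" using Cons.prems by (simp flip: one_free)
    then show ?thesis using True by (intro exI[of _ "[]"] exI[of _ b] exI[of _ w]) simp
  next
    case False
    then have "flow N a w (inv [b] \<otimes> g) \<noteq> 0" using b(2) Cons.prems by (auto simp: flow_Cons)
    then obtain v c v' where v: "w = v @ c # v'"
      "c = a \<and> inv v \<otimes> (inv [b] \<otimes> g) \<in> N \<or> c = letter_inv a \<and> inv v \<otimes> (inv [b] \<otimes> g) \<otimes> [a] \<in> N"
      using Cons.IH[of "inv [b] \<otimes> g"] Cons.prems b by auto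
    have "(b # v) @ c # v' \<in> carrier F" using Cons.prems v by simp
    then have "b # v \<in> carrier F" by (rule append_carrier)
    note bv = Cons_carrier[OF this]
    have "inv (b # v) \<otimes> g = inv v \<otimes> (inv [b] \<otimes> g)"
      unfolding bv(1) using bv(3,4) Cons.prems by (simp add: inv_mult_group m_assoc)
    then show ?thesis using v
      by (intro exI[of _ "b # v"] exI[of _ c] exI[of _ v']) simp
  qed
qed simp

text \<open>A shortest nontrivial word of \<open>N\<close> passes its first edge only once: a second
  passage would cut off a shorter nontrivial word of \<open>N\<close> or contradict
  reducedness.\<close>

lemma exists_flow_nonzero:
  assumes "N \<noteq> {\<one>}"
  shows "\<exists>a u. fst a \<in> I \<and> u \<in> N \<and> flow N a u \<one> \<noteq> 0"
proof -
  have "\<exists>u. u \<in> N \<and> u \<noteq> []" using assms subgroup.one_closed[OF is_subgroup] one_free by auto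
  then obtain u where u: "u \<in> N" "u \<noteq> []" and min: "\<And>v. v \<in> N \<and> v \<noteq> [] \<Longrightarrow> length u \<le> length v"
    using ex_has_least_nat[of "\<lambda>u. u \<in> N \<and> u \<noteq> []" _ length] by blast
  then obtain a w where aw: "u = a # w" by (cases u) auto
  have "a # w \<in> carrier F" using u aw by auto
  note a = Cons_carrier[OF this]
  have "flow N a w (inv [a] \<otimes> \<one>) = 0"
  proof (rule ccontr)
    assume "flow N a w (inv [a] \<otimes> \<one>) \<noteq> 0"
    then obtain v b v' where v: "w = v @ b # v'"
      "b = a \<and> inv v \<otimes> inv [a] \<in> N \<or> b = letter_inv a \<and> inv v \<otimes> inv [a] \<otimes> [a] \<in> N"
      using flow_nonzero_split[of a w "inv [a]"] a(2-4) by auto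
    have "(a # v) @ b # v' \<in> carrier F" using \<open>a # w \<in> carrier F\<close> v by simp
    then have "a # v \<in> carrier F" by (rule append_carrier)
    note av = Cons_carrier[OF this]
    from v(2) show False
    proof (elim disjE conjE)
      assume "inv v \<otimes> inv [a] \<in> N"
      then have "inv (a # v) \<in> N" unfolding av(1) using av(3,4) by (simp add: inv_mult_group)
      then have "inv (inv (a # v)) \<in> N" by (rule m_inv_closed)
      then have "a # v \<in> N" using \<open>a # v \<in> carrier F\<close> by simp
      then show False using min[of "a # v"] aw v by simp
    next
      \<comment> \<open>A backward passage returns to the end of the first edge, so \<open>v\<close>
        is a shorter closed path; it must be empty, and then the word begins with \<open>a\<close>
        followed by its inverse.\<close>
      assume b: "b = letter_inv a" and "inv v \<otimes> inv [a] \<otimes> [a] \<in> N"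
      then have "inv v \<in> N" using av(3,4) by (simp add: m_assoc)
      then have "inv (inv v) \<in> N" by (rule m_inv_closed)
      then have "v \<in> N" using av(3) by simp
      then have "v = []" using min[of v] aw v by fastforce
      then show False using \<open>a # w \<in> carrier F\<close> v b by (auto simp: carrier_free reduced_Cons)
    qed
  qed
  then have "flow N a u \<one> \<noteq> 0"
    using a(2) letter_inv_neq[of a] unfolding aw by (auto simp: flow_Cons)
  then show ?thesis using u a(2) by blast
qed

section \<open>Separating branches by their flows\<close>

lemma branch_quotient_mem:
  assumes "length bs = length bs'" "u \<in> N" "x \<in> carrier F"
  shows "inv (branch F u x bs) \<otimes> branch F u x bs' \<in> N"
  using assms(1)
proof (induction rule: list_induct2)
  case (Cons b bs b' bs')
  let ?p = "inv (branch F u x bs) \<otimes> branch F u x bs'" and ?u = "\<lambda>b. if b then u else \<one>"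
  have "inv (branch F u x (b # bs)) \<otimes> branch F u x (b' # bs') = inv (?u b) \<otimes> (inv x \<otimes> ?p \<otimes> x) \<otimes> ?u b'"
    using assms(2,3) by (simp add: inv_mult_group m_assoc)
  then show ?case using Cons assms inv_op_closed1[of x ?p] by simp
qed simp

text \<open>Conjugation by \<open>inv x\<close> shifts the argument to \<open>x \<otimes> g\<close>.
  Iterated, the flow becomes the sum over positions \<open>k\<close> of \<open>b' - b\<close> at
  \<open>k\<close> times the flow of \<open>u\<close> at \<open>x [^] k \<otimes> g\<close>.\<close>

lemma flow_branch_quotient_Cons:
  assumes "length bs = length bs'" "u \<in> N" "x \<in> carrier F" "fst a \<in> I" "g \<in> carrier F"
  shows "flow N a (inv (branch F u x (b # bs)) \<otimes> branch F u x (b' # bs')) g =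
    flow N a (inv (branch F u x bs) \<otimes> branch F u x bs') (x \<otimes> g) +
    (of_bool b' - of_bool b) * flow N a u g"
proof -
  let ?p = "inv (branch F u x bs) \<otimes> branch F u x bs'" and ?u = "\<lambda>b. if b then u else \<one>"
  have p: "?p \<in> N" using assms by (intro branch_quotient_mem)
  have p': "inv x \<otimes> ?p \<otimes> x \<in> N" using inv_op_closed1[of x ?p] p assms by simp
  have "inv (branch F u x (b # bs)) \<otimes> branch F u x (b' # bs') = inv (?u b) \<otimes> ((inv x \<otimes> ?p \<otimes> x) \<otimes> ?u b')"
    using assms(2,3) by (simp add: inv_mult_group m_assoc)
  moreover have "flow N a (inv x \<otimes> ?p \<otimes> x) g = flow N a ?p (x \<otimes> g)"
    using flow_conj[of a "inv x" ?p g] p assms by simp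
  ultimately show ?thesis
    using flow_mult_mem[of a "inv (?u b)" "(inv x \<otimes> ?p \<otimes> x) \<otimes> ?u b'" g]
      flow_mult_mem[of a "inv x \<otimes> ?p \<otimes> x" "?u b'" g] p p' assms
    by (auto simp: flow_inv_mem)
qed

text \<open>The flow is that of \<open>u\<close> multiplied by a polynomial in \<open>x\<close> with
  coefficients in -1, 0, 1. At an extreme point of the support only the heads of the lists
  contribute, so zero flow forces equal heads, then equal tails.\<close>

lemma flow_branch_quotient:
  assumes x: "x \<in> carrier F" "\<And>k. k > 0 \<Longrightarrow> x [^] (k::nat) \<notin> N"
    and u: "u \<in> N" and a: "fst a \<in> I" and g: "g \<in> carrier F" "flow N a u g \<noteq> 0"
    and bs: "length bs = length bs'" "bs \<noteq> bs'"
  shows "\<exists>g \<in> carrier F. flow N a (inv (branch F u x bs) \<otimes> branch F u x bs') g \<noteq> 0"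
proof -
  define K where "K = {k::nat. flow N a u (x [^] k \<otimes> g) \<noteq> 0}"
  have K: "finite K" unfolding K_def using x u a g by (intro finite_flow_orbit) auto
  have "0 \<in> K" using g by (simp add: K_def)
  \<comment> \<open>The last of the points \<open>x [^] k \<otimes> g\<close> at which
    \<open>u\<close> has nonzero flow.\<close>
  define y where "y = x [^] Max K \<otimes> g"
  have y: "y \<in> carrier F" using x g by (simp add: y_def)
  have "Max K \<in> K" using K \<open>0 \<in> K\<close> by (intro Max_in) auto
  then have y_nz: "flow N a u y \<noteq> 0" unfolding K_def y_def by simp
  have y_0: "flow N a u (x [^] k \<otimes> y) = 0" if "k > 0" for k :: nat
  proof -
    have "k + Max K \<notin> K" using Max_ge[OF K, of "k + Max K"] that by auto
    then show ?thesis using x g by (simp add: K_def y_def nat_pow_mult[symmetric] m_assoc)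
  qed
  have vanish: "flow N a (inv (branch F u x bs) \<otimes> branch F u x bs') (x [^] k \<otimes> y) = 0"
    if "length bs = length bs'" "k > 0" for k :: nat and bs bs'
    using that
  proof (induction arbitrary: k rule: list_induct2)
    case Nil
    then show ?case using a by simp
  next
    case (Cons b bs b' bs')
    have "x \<otimes> (x [^] k \<otimes> y) = x [^] Suc k \<otimes> y"
      using x y by (subst nat_pow_Suc2) (auto simp: m_assoc)
    then show ?case
      using Cons.IH[of "Suc k"] Cons.hyps Cons.prems y_0[of k] x u a y
      by (simp add: flow_branch_quotient_Cons del: branch.simps nat_pow_Suc)
  qed
  have "bs = bs'" if "\<forall>g \<in> carrier F. flow N a (inv (branch F u x bs) \<otimes> branch F u x bs') g = 0"
    using bs(1) that
  proof (induction rule: list_induct2)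
    case (Cons b bs b' bs')
    have "flow N a (inv (branch F u x bs) \<otimes> branch F u x bs') (x \<otimes> y) = 0"
      using vanish[of bs bs' 1] Cons.hyps x by simp
    then have b: "b = b'"
      using Cons.prems[rule_format, OF y] y_nz Cons.hyps x u a y
      by (auto simp: flow_branch_quotient_Cons simp del: branch.simps split: if_splits)
    \<comment> \<open>Evaluation at \<open>inv x \<otimes> g\<close>, where equal heads cancel,
      passes the vanishing on to the tails.\<close>
    have "flow N a (inv (branch F u x bs) \<otimes> branch F u x bs') g = 0" if g: "g \<in> carrier F" for g
      using Cons.prems[rule_format, of "inv x \<otimes> g"] Cons.hyps x u a g b
      by (simp add: flow_branch_quotient_Cons del: branch.simps)
    then show ?case using Cons.IH b by simp
  qed simp
  then show ?thesis using bs(2) by blast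
qed

end

section \<open>The derived series of a free group\<close>

text \<open>
  The permutations \<open>x = (1 2 3 4 5)\<close> and \<open>y = (1 2 4 5 3)\<close> satisfy \<open>x = [yx, y]\<close> and
  \<open>y = [xy, x]\<close>, so they generate a perfect group.
\<close>

lemma (in group_hom) exp_of_derived_nontrivial:
  assumes x: "x \<in> carrier G" and y: "y \<in> carrier G"
    and rel: "h x \<otimes>\<^bsub>H\<^esub> h y \<otimes>\<^bsub>H\<^esub> h y \<otimes>\<^bsub>H\<^esub> h x = h y \<otimes>\<^bsub>H\<^esub> h x \<otimes>\<^bsub>H\<^esub> h y"
      "h y \<otimes>\<^bsub>H\<^esub> h x \<otimes>\<^bsub>H\<^esub> h x \<otimes>\<^bsub>H\<^esub> h y = h x \<otimes>\<^bsub>H\<^esub> h y \<otimes>\<^bsub>H\<^esub> h x"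
    and "h x \<noteq> \<one>\<^bsub>H\<^esub>"
  shows "(derived G ^^ n) (carrier G) \<noteq> {\<one>}"
proof -
  let ?D = "\<lambda>n. (derived G ^^ n) (carrier G)"
  have "\<exists>a b. a \<in> ?D n \<and> b \<in> ?D n \<and> h a = h x \<and> h b = h y"
  proof (induction n)
    case 0
    then show ?case using x y by auto
  next
    case (Suc n)
    then obtain a b where ab: "a \<in> ?D n" "b \<in> ?D n" "h a = h x" "h b = h y" by blast
    interpret D: subgroup "?D n" G by (intro G.exp_of_derived_is_subgroup G.subgroup_self)
    let ?c = "\<lambda>p q. p \<otimes> q \<otimes> inv p \<otimes> inv q"
    have comm: "?c p q \<in> ?D (Suc n)" if "p \<in> ?D n" "q \<in> ?D n" for p q
      using that by (auto simp: derived_def intro!: generate.incl)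
    have "h (?c (b \<otimes> a) b) = h x"
    proof -
      have "h (?c (b \<otimes> a) b) = h b \<otimes>\<^bsub>H\<^esub> h a \<otimes>\<^bsub>H\<^esub> h b \<otimes>\<^bsub>H\<^esub> inv\<^bsub>H\<^esub> (h b \<otimes>\<^bsub>H\<^esub> h a) \<otimes>\<^bsub>H\<^esub> inv\<^bsub>H\<^esub> h b"
        using ab by simp
      also have "\<dots> = h x"
        using x y unfolding ab(3,4) rel(1)[symmetric]
        by (simp add: H.inv_mult_group H.m_assoc)
      finally show ?thesis .
    qed
    moreover have "h (?c (a \<otimes> b) a) = h y"
    proof -
      have "h (?c (a \<otimes> b) a) = h a \<otimes>\<^bsub>H\<^esub> h b \<otimes>\<^bsub>H\<^esub> h a \<otimes>\<^bsub>H\<^esub> inv\<^bsub>H\<^esub> (h a \<otimes>\<^bsub>H\<^esub> h b) \<otimes>\<^bsub>H\<^esub> inv\<^bsub>H\<^esub> h a"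
        using ab by simp
      also have "\<dots> = h y"
        using x y unfolding ab(3,4) rel(2)[symmetric]
        by (simp add: H.inv_mult_group H.m_assoc)
      finally show ?thesis .
    qed
    ultimately show ?case
      using comm[of "b \<otimes> a" b] comm[of "a \<otimes> b" a] ab D.m_closed by blast
  qed
  then show ?thesis using assms(5) by force
qed

lemma free_group_derived_nontrivial:
  fixes I :: "'i set"
  assumes "i \<in> I" "j \<in> I" "i \<noteq> j"
  shows "(derived (free_group I) ^^ n) (carrier (free_group I)) \<noteq> {\<one>\<^bsub>free_group I\<^esub>}"
proof -
  define x where "x = cycle_of_list [1, 2, 3, 4, 5 :: nat]"
  define y where "y = cycle_of_list [1, 2, 4, 5, 3 :: nat]"
  let ?H = "sym_group 5"
  interpret H: group ?H by (rule sym_group_is_group)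
  have x: "x \<in> carrier ?H" and y: "y \<in> carrier ?H"
    unfolding sym_group_carrier x_def y_def
    by (rule permutes_subset[OF cycle_permutes]; simp)+
  have vals: "x 1 = 2" "x 2 = 3" "x 3 = 4" "x 4 = 5" "x 5 = 1"
    "y 1 = 2" "y 2 = 4" "y 4 = 5" "y 5 = 3" "y 3 = 1"
    by (simp_all add: x_def y_def transpose_def)
  have fixed: "x k = k" "y k = k" if "k \<notin> {1..5}" for k
    using x y that unfolding sym_group_carrier by (meson permutes_not_in)+
  have pointwise: "(x \<circ> y \<circ> y \<circ> x) k = (y \<circ> x \<circ> y) k \<and> (y \<circ> x \<circ> x \<circ> y) k = (x \<circ> y \<circ> x) k" for k
  proof (cases "k \<in> {1..5}")
    case True
    then have "k = 1 \<or> k = 2 \<or> k = 3 \<or> k = 4 \<or> k = 5" by auto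
    then show ?thesis by (elim disjE) (simp_all only: o_apply vals)
  qed (simp add: fixed)
  have rel: "x \<circ> y \<circ> y \<circ> x = y \<circ> x \<circ> y" "y \<circ> x \<circ> x \<circ> y = x \<circ> y \<circ> x"
    by (rule ext, use pointwise in blast)+
  \<comment> \<open>The generator \<open>i\<close> goes to the first 5-cycle and every other one, in
    particular \<open>j\<close>, to the second.\<close>
  obtain h where h: "h \<in> hom (free_group I) ?H"
    and hi: "\<forall>k\<in>I. h [(k, True)] = (if k = i then x else y)"
    using free_group_universal(1)[OF H.is_group, of "\<lambda>k. if k = i then x else y" I] x y by auto
  interpret group_hom "free_group I" ?H h
    using h group_free_group by (simp add: group_hom_def group_hom_axioms_def H.is_group)
  have hx: "h [(i, True)] = x" and hy: "h [(j, True)] = y" using hi assms by auto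
  have "x \<noteq> id" using vals(1) by auto
  then show ?thesis
    using assms
    by (intro exp_of_derived_nontrivial[of "[(i, True)]" "[(j, True)]"])
      (simp_all add: hx hy sym_group_mult sym_group_one rel)
qed

section \<open>Points moved by finitely many elements\<close>

text \<open>Otherwise colour class \<open>p\<close> meets each line in direction \<open>p\<close> at
  most once, so it has at most \<open>(r + 1) ^ (r - 1)\<close> points, where
  \<open>r = card P\<close>. The \<open>r\<close> classes then cannot fill the
  \<open>(r + 1) ^ r\<close> points of the box.\<close>

lemma covered_box_has_line:
  fixes A :: "'p \<Rightarrow> ('p \<Rightarrow> nat) \<Rightarrow> bool"
  assumes P: "finite P" and cover: "\<And>n. n \<in> P \<rightarrow>\<^sub>E {..card P} \<Longrightarrow> \<exists>p\<in>P. A p n"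
  shows "\<exists>p\<in>P. \<exists>n k. 0 < k \<and> k \<le> card P \<and> A p n \<and> A p (n(p := n p + k))"
proof (rule ccontr)
  assume contra: "\<not> ?thesis"
  let ?r = "card P" and ?B = "P \<rightarrow>\<^sub>E {..card P}"
  have fin: "finite ?B" using P by (intro finite_PiE) auto
  have "card {n \<in> ?B. A p n} \<le> (?r + 1) ^ (?r - 1)" if p: "p \<in> P" for p
  proof -
    have le: "\<not> n p < n' p" if "n \<in> ?B" "n' \<in> ?B" "A p n" "A p n'"
      "restrict n (P - {p}) = restrict n' (P - {p})" for n n'
    proof
      assume less: "n p < n' p"
      have "n' = n(p := n p + (n' p - n p))"
      proof
        fix q
        show "n' q = (n(p := n p + (n' p - n p))) q"
        proof (cases "q \<in> P - {p}")
          case True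
          then show ?thesis using fun_cong[OF that(5), of q] by simp
        next
          case False
          then show ?thesis using that(1,2) less by (cases "q = p") (auto simp: PiE_arb[of _ P])
        qed
      qed
      moreover have "n' p \<le> ?r" using that(2) p by (auto simp: PiE_iff)
      ultimately show False
        using contra p that(3,4) less
        by (metis diff_le_self le_trans zero_less_diff)
    qed
    have "inj_on (\<lambda>n. restrict n (P - {p})) {n \<in> ?B. A p n}"
    proof (rule inj_onI)
      fix n n' assume n: "n \<in> {n \<in> ?B. A p n}" "n' \<in> {n \<in> ?B. A p n}"
        and eq: "restrict n (P - {p}) = restrict n' (P - {p})"
      have "n p = n' p" using le[of n n'] le[of n' n] n eq by force
      moreover have "n q = n' q" if "q \<in> P - {p}" for q using fun_cong[OF eq, of q] that by simp
      ultimately have "n q = n' q" if "q \<in> P" for q using that by (cases "q = p") auto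
      then show "n = n'" using n by (intro PiE_ext[of n P _ n']) auto
    qed
    moreover have "(\<lambda>n. restrict n (P - {p})) ` {n \<in> ?B. A p n} \<subseteq> (P - {p}) \<rightarrow>\<^sub>E {..?r}"
      unfolding image_subset_iff restrict_PiE_iff by (auto simp: PiE_iff)
    ultimately have "card {n \<in> ?B. A p n} \<le> card ((P - {p}) \<rightarrow>\<^sub>E {..?r})"
      using P by (intro card_inj_on_le) (auto intro!: finite_PiE)
    also have "\<dots> = (?r + 1) ^ (?r - 1)" using P p by (simp add: card_PiE)
    finally show ?thesis .
  qed
  then have "(\<Sum>p\<in>P. card {n \<in> ?B. A p n}) \<le> ?r * (?r + 1) ^ (?r - 1)"
    using sum_bounded_above[of P "\<lambda>p. card {n \<in> ?B. A p n}"] by simp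
  moreover have "card ?B \<le> (\<Sum>p\<in>P. card {n \<in> ?B. A p n})"
  proof -
    have "?B = (\<Union>p\<in>P. {n \<in> ?B. A p n})" using cover by blast
    then show ?thesis using card_UN_le[OF P, of "\<lambda>p. {n \<in> ?B. A p n}"] by simp
  qed
  moreover have "card ?B = (?r + 1) ^ ?r" using P by (simp add: card_PiE)
  moreover have "?r * (?r + 1) ^ (?r - 1) < (?r + 1) ^ ?r"
  proof -
    \<comment> \<open>The zero point has a colour, so \<open>P\<close> is nonempty and the exponent
      \<open>card P - 1\<close> is not truncated.\<close>
    have "(\<lambda>p\<in>P. 0) \<in> ?B" by auto
    then have "P \<noteq> {}" using cover by blast
    then have "?r \<noteq> 0" using P by simp
    then have "(?r + 1) ^ ?r = (?r + 1) * (?r + 1) ^ (?r - 1)" by (simp add: power_eq_if)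
    then show ?thesis by simp
  qed
  ultimately show False by linarith
qed

section \<open>Commutators as operators on an abelian normal subgroup\<close>

definition commutator :: "('a, 'b) monoid_scheme \<Rightarrow> 'a \<Rightarrow> 'a \<Rightarrow> 'a" where
  "commutator G x y = x \<otimes>\<^bsub>G\<^esub> y \<otimes>\<^bsub>G\<^esub> inv\<^bsub>G\<^esub> x \<otimes>\<^bsub>G\<^esub> inv\<^bsub>G\<^esub> y"

lemma (in group_hom) hom_commutator:
  "\<lbrakk>x \<in> carrier G; y \<in> carrier G\<rbrakk> \<Longrightarrow> h (commutator G x y) = commutator H (h x) (h y)"
  by (simp add: commutator_def)

lemma (in group) commutator_closed [simp]:
  "\<lbrakk>x \<in> carrier G; y \<in> carrier G\<rbrakk> \<Longrightarrow> commutator G x y \<in> carrier G"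
  by (simp add: commutator_def)

lemma (in group) commutator_eq_one_iff:
  assumes "x \<in> carrier G" "y \<in> carrier G"
  shows "commutator G x y = \<one> \<longleftrightarrow> x \<otimes> y = y \<otimes> x"
proof -
  have "commutator G x y = (x \<otimes> y) \<otimes> inv (y \<otimes> x)"
    using assms by (simp add: commutator_def inv_mult_group m_assoc)
  moreover have "a \<otimes> inv b = \<one> \<longleftrightarrow> a = b" if "a \<in> carrier G" "b \<in> carrier G" for a b
    using that by (metis inv_closed inv_equality inv_inv r_inv)
  ultimately show ?thesis using assms by (metis m_closed)
qed

locale abelian_normal = normal M G for M and G (structure) +
  assumes comm: "\<lbrakk>x \<in> M; y \<in> M\<rbrakk> \<Longrightarrow> x \<otimes> y = y \<otimes> x"
begin

lemma mem_mult [simp]: "\<lbrakk>x \<in> M; y \<in> M\<rbrakk> \<Longrightarrow> x \<otimes> y \<in> M"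
  by (rule subgroup.m_closed[OF is_subgroup])

lemma lcomm: "\<lbrakk>x \<in> M; y \<in> M; z \<in> M\<rbrakk> \<Longrightarrow> x \<otimes> (y \<otimes> z) = y \<otimes> (x \<otimes> z)"
  using comm[of x y] by (simp flip: m_assoc)

lemma mem_pow [simp]: "u \<in> M \<Longrightarrow> u [^] (k::nat) \<in> M"
  by (induction k) (auto intro: subgroup.one_closed[OF is_subgroup])

lemma commutator_mem: "\<lbrakk>p \<in> carrier G; u \<in> M\<rbrakk> \<Longrightarrow> commutator G p u \<in> M"
  using inv_op_closed2[of p u] by (simp add: commutator_def)

text \<open>Conjugation by \<open>p\<close> is a homomorphism, and the factors can be regrouped
  inside the abelian group \<open>M\<close>.\<close>

lemma commutator_mult:
  assumes p: "p \<in> carrier G" and uw: "u \<in> M" "w \<in> M"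
  shows "commutator G p (u \<otimes> w) = commutator G p u \<otimes> commutator G p w"
proof -
  let ?c = "\<lambda>u. p \<otimes> u \<otimes> inv p"
  have M: "?c u \<in> M" "?c w \<in> M" using assms inv_op_closed2 by auto
  have "commutator G p (u \<otimes> w) = ?c u \<otimes> ?c w \<otimes> (inv u \<otimes> inv w)"
    using assms comm[of "inv u" "inv w"] by (simp add: commutator_def inv_mult_group m_assoc)
  also have "\<dots> = (?c u \<otimes> inv u) \<otimes> (?c w \<otimes> inv w)"
    using M uw lcomm[of "?c w" "inv u" "inv w"] by (simp add: m_assoc)
  finally show ?thesis by (simp add: commutator_def)
qed

lemma commutator_pow:
  assumes "p \<in> carrier G" "u \<in> M"
  shows "commutator G p (u [^] (k::nat)) = commutator G p u [^] k"
  using assms by (induction k) (simp_all add: commutator_mult, simp add: commutator_def)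

text \<open>Conjugations by \<open>p \<otimes> q\<close> and \<open>q \<otimes> p\<close> differ by
  conjugation with an element of \<open>M\<close>, which is trivial on the abelian group
  \<open>M\<close>. Expanding both sides then gives the same four factors.\<close>

lemma commutator_left_commute:
  assumes p: "p \<in> carrier G" and q: "q \<in> carrier G" and u: "u \<in> M" and pq: "commutator G p q \<in> M"
  shows "commutator G p (commutator G q u) = commutator G q (commutator G p u)"
proof -
  let ?c = "\<lambda>p u. p \<otimes> u \<otimes> inv p"
  have c: "?c p u \<in> M" if "p \<in> carrier G" "u \<in> M" for p u using that inv_op_closed2 by auto
  have U: "u \<in> carrier G" using u by simp
  have expand: "commutator G p (commutator G q u) = ?c p (?c q u) \<otimes> (?c p (inv u) \<otimes> (?c q (inv u) \<otimes> u))"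
    if "p \<in> carrier G" "q \<in> carrier G" for p q
  proof -
    have "commutator G p (commutator G q u) = ?c p (?c q u) \<otimes> (?c p (inv u) \<otimes> (u \<otimes> ?c q (inv u)))"
      using that U by (simp add: commutator_def inv_mult_group m_assoc)
    then show ?thesis using comm[of u "?c q (inv u)"] c[of q "inv u"] that u by simp
  qed
  have "?c p (?c q u) = ?c (commutator G p q) (?c (q \<otimes> p) u)"
    using p q U by (simp add: commutator_def inv_mult_group m_assoc)
  also have "\<dots> = ?c (q \<otimes> p) u"
    using comm[OF pq c[of "q \<otimes> p" u]] c[of "q \<otimes> p" u] p q u pq by (simp add: m_assoc)
  also have "\<dots> = ?c q (?c p u)" using p q U by (simp add: inv_mult_group m_assoc)
  finally have "?c p (?c q u) = ?c q (?c p u)" .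
  moreover have "?c p (inv u) \<otimes> (?c q (inv u) \<otimes> u) = ?c q (inv u) \<otimes> (?c p (inv u) \<otimes> u)"
    using p q u c by (intro lcomm) auto
  ultimately show ?thesis using expand[OF p q] expand[OF q p] by simp
qed

text \<open>The intended \<open>m n\<close> is the product of the \<open>u p [^] n p\<close>; its
  change along coordinate lines is what \<open>covered_box_has_line\<close> exploits.\<close>

lemma exists_box_product:
  assumes "finite P" "u \<in> P \<rightarrow> M"
  shows "\<exists>m :: ('p \<Rightarrow> nat) \<Rightarrow> 'a. \<forall>n. m n \<in> M \<and> (\<forall>p. \<forall>k.
    m (n(p := n p + k)) = (if p \<in> P then m n \<otimes> u p [^] k else m n))"
  using assms
proof (induction P rule: finite_induct)
  case empty
  show ?case by (rule exI[of _ "\<lambda>_. \<one>"]) (simp add: subgroup.one_closed[OF is_subgroup])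
next
  case (insert q P)
  then obtain m :: "('p \<Rightarrow> nat) \<Rightarrow> 'a" where "\<forall>n. m n \<in> M \<and> (\<forall>p. \<forall>k.
    m (n(p := n p + k)) = (if p \<in> P then m n \<otimes> u p [^] k else m n))"
    by blast
  then have m: "\<And>n. m n \<in> M"
    "\<And>n p k. m (n(p := n p + k)) = (if p \<in> P then m n \<otimes> u p [^] k else m n)"
    by blast+
  have uM: "u p \<in> M" if "p \<in> insert q P" for p using insert.prems that by auto
  show ?case
  proof (intro exI[of _ "\<lambda>n. m n \<otimes> u q [^] n q"] allI conjI)
    fix n p and k :: nat
    show "m n \<otimes> u q [^] n q \<in> M" using m uM by simp
    show "m (n(p := n p + k)) \<otimes> u q [^] (n(p := n p + k)) q =
      (if p \<in> insert q P then m n \<otimes> u q [^] n q \<otimes> u p [^] k else m n \<otimes> u q [^] n q)"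
    proof (cases "p = q")
      case True
      then show ?thesis using insert.hyps(2) m uM by (simp add: nat_pow_mult[symmetric] m_assoc)
    next
      case False
      then show ?thesis using m uM comm[of "u p [^] k" "u q [^] n q"] by (simp add: m_assoc)
    qed
  qed
qed

text \<open>
  \<open>commutator G p\<close> acts on \<open>M\<close> as the ring element \<open>p - 1\<close>; the common value \<open>v\<close> is the image of a
  nonzero element under the product of all these operators.
\<close>

lemma exists_common_commutator:
  assumes "finite P" "P \<subseteq> carrier G" and PP: "\<And>p q. \<lbrakk>p \<in> P; q \<in> P\<rbrakk> \<Longrightarrow> commutator G p q \<in> M"
    and R: "w \<in> M" "R w" "\<And>p u. \<lbrakk>p \<in> P; u \<in> M; R u\<rbrakk> \<Longrightarrow> R (commutator G p u)"
  shows "\<exists>v \<in> M. R v \<and> (\<exists>u \<in> P \<rightarrow> M. \<forall>p\<in>P. commutator G p (u p) = v)"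
  using assms(1,2) PP R(3)
proof (induction P rule: finite_induct)
  case empty
  then show ?case using R by auto
next
  case (insert q P)
  then obtain v u where v: "v \<in> M" "R v" and u: "u \<in> P \<rightarrow> M" "\<forall>p\<in>P. commutator G p (u p) = v"
    by auto
  \<comment> \<open>Applying \<open>q - 1\<close> to the old witnesses and taking \<open>v\<close>
    itself for \<open>q\<close> makes all values equal to \<open>(q - 1) v\<close>, because the
    operators commute.\<close>
  let ?u = "(\<lambda>p. commutator G q (u p))(q := v)"
  have q: "q \<in> carrier G" using insert.prems by simp
  have "?u \<in> insert q P \<rightarrow> M" using v u q by (auto intro!: commutator_mem)
  moreover have "commutator G p (?u p) = commutator G q v" if "p \<in> insert q P" for p
  proof (cases "p = q")
    case False
    then have p: "p \<in> P" using that by simp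
    then have "commutator G p (commutator G q (u p)) = commutator G q (commutator G p (u p))"
      using u q insert.prems by (intro commutator_left_commute) auto
    then show ?thesis using False p u by simp
  qed simp
  moreover have "R (commutator G q v)" using v insert.prems(3)[of q v] by simp
  ultimately show ?case using commutator_mem[OF q v(1)] by blast
qed

end

section \<open>Fixed points of faithful actions\<close>

lemma (in group_action) fixed_inv:
  assumes "g \<in> carrier G" "x \<in> E" "\<phi> g x = x"
  shows "\<phi> (inv g) x = x"
  using orbit_sym_aux[OF assms] .

lemma (in group_action) fixed_pow:
  assumes "g \<in> carrier G" "x \<in> E" "\<phi> g x = x"
  shows "\<phi> (g [^] (k::nat)) x = x"
proof -
  interpret group G using group_hom group_hom.axioms(1) by auto
  show ?thesis
    using assms by (induction k) (simp_all add: composition_rule flip: id_eq_one)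
qed

lemma (in faithful_action) eq_one_if_fixes_all:
  assumes "g \<in> carrier G" "\<And>x. x \<in> E \<Longrightarrow> \<phi> g x = x"
  shows "g = \<one>"
proof -
  interpret group G using group_hom group_hom.axioms(1) by auto
  \<comment> \<open>The permutations are extensional on \<open>E\<close>, so agreement on
    \<open>E\<close> makes them equal.\<close>
  have "\<phi> g = \<phi> \<one>"
    using assms bij_prop0[of g] by (auto simp: id_eq_one[symmetric] Bij_def extensional_def fun_eq_iff)
  then show ?thesis using faithful assms(1) by (auto dest: inj_onD)
qed

text \<open>
  If every point were fixed by an element of \<open>P\<close>, then a point \<open>x\<close> would be fixed by a bounded
  power of \<open>commutator G p (u p)\<close> for some \<open>p \<in> P\<close>, by counting among the translates of \<open>x\<close> under
  products of the \<open>u p\<close> (a quantitative form of B. H. Neumann's lemma on coverings by cosets). Choosing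
  \<open>u\<close> so that this commutator does not depend on \<open>p\<close> contradicts faithfulness.
\<close>

lemma (in faithful_action) exists_point_moved:
  assumes M: "abelian_normal M G" and P: "finite P" "P \<subseteq> carrier G"
    and PP: "\<And>p q. \<lbrakk>p \<in> P; q \<in> P\<rbrakk> \<Longrightarrow> commutator G p q \<in> M"
    and w: "w \<in> M" "R w" and R: "\<And>p u. \<lbrakk>p \<in> P; u \<in> M; R u\<rbrakk> \<Longrightarrow> R (commutator G p u)"
      "\<And>u k. \<lbrakk>u \<in> M; R u; k > 0\<rbrakk> \<Longrightarrow> R (u [^] (k::nat))" "\<not> R \<one>"
  shows "\<exists>x\<in>E. \<forall>p\<in>P. \<phi> p x \<noteq> x"
proof (rule ccontr)
  assume "\<not> ?thesis"
  then have cover: "\<exists>p\<in>P. \<phi> p x = x" if "x \<in> E" for x using that by blast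
  interpret abelian_normal M G by fact
  obtain v u where v: "v \<in> M" "R v" and u: "u \<in> P \<rightarrow> M" "\<And>p. p \<in> P \<Longrightarrow> commutator G p (u p) = v"
    using exists_common_commutator[where P = P and w = w and R = R, OF P PP w R(1)] by blast
  obtain m :: "('a \<Rightarrow> nat) \<Rightarrow> 'a" where "\<forall>n. m n \<in> M \<and> (\<forall>p. \<forall>k.
    m (n(p := n p + k)) = (if p \<in> P then m n \<otimes> u p [^] k else m n))"
    using exists_box_product[OF P(1) u(1)] by blast
  then have m: "\<And>n. m n \<in> M" "\<And>n p k. p \<in> P \<Longrightarrow> m (n(p := n p + k)) = m n \<otimes> u p [^] k"
    by simp_all
  have mult: "\<phi> (g \<otimes> k) x = \<phi> g (\<phi> k x)" if "g \<in> carrier G" "k \<in> carrier G" "x \<in> E" for g k x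
    using that by (intro composition_rule)
  have img: "\<phi> g x \<in> E" if "g \<in> carrier G" "x \<in> E" for g x using element_image that by blast
  \<comment> \<open>The exponent \<open>k\<close> found below depends on \<open>x\<close> but is at
    most \<open>card P\<close>; the factorial is a common multiple.\<close>
  have "\<phi> (v [^] (fact (card P) :: nat)) x = x" if x: "x \<in> E" for x
  proof -
    \<comment> \<open>The point \<open>n\<close> of the box gets colour \<open>p\<close> when
      \<open>p\<close> fixes the translate of \<open>x\<close> by \<open>m n\<close>.\<close>
    have "\<exists>p\<in>P. \<exists>n k. 0 < k \<and> k \<le> card P \<and> \<phi> p (\<phi> (m n) x) = \<phi> (m n) x \<and>
        \<phi> p (\<phi> (m (n(p := n p + k))) x) = \<phi> (m (n(p := n p + k))) x"
      using P(1) cover img[of "m _" x] m(1) x by (intro covered_box_has_line) auto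
    then obtain p n k where p: "p \<in> P" and k: "0 < k" "k \<le> card P"
      and fixed: "\<phi> p (\<phi> (m n) x) = \<phi> (m n) x"
        "\<phi> p (\<phi> (m n \<otimes> u p [^] k) x) = \<phi> (m n \<otimes> u p [^] k) x"
      using m(2) by metis
    define y where "y = \<phi> (m n) x"
    define t where "t = u p [^] k"
    have up: "u p \<in> M" using u(1) p by blast
    then have t: "t \<in> M" by (simp add: t_def)
    have pG: "p \<in> carrier G" and mG: "m n \<in> carrier G" using p P m by auto
    have y: "y \<in> E" using img x mG by (simp add: y_def)
    have tG: "t \<in> carrier G" using t by simp
    have "m n \<otimes> t = t \<otimes> m n" using comm m t by simp
    then have "\<phi> (m n \<otimes> t) x = \<phi> t y" using mult tG mG x by (simp add: y_def)
    then have pt: "\<phi> p (\<phi> t y) = \<phi> t y" and py: "\<phi> p y = y"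
      using fixed by (auto simp: y_def t_def)
    \<comment> \<open>Since \<open>p\<close> fixes both \<open>y\<close> and its translate by
      \<open>t\<close>, the commutator moves the latter to \<open>y\<close>, back again, and fixes
      it.\<close>
    have "\<phi> (commutator G p t) (\<phi> t y) = \<phi> (p \<otimes> t \<otimes> inv p) (\<phi> (inv t) (\<phi> t y))"
      unfolding commutator_def using mult img pG tG y by simp
    also have "\<phi> (inv t) (\<phi> t y) = y" using orbit_sym_aux[OF tG y refl] .
    also have "\<phi> (p \<otimes> t \<otimes> inv p) y = \<phi> p (\<phi> t (\<phi> (inv p) y))"
      using mult img pG tG y by simp
    also have "\<dots> = \<phi> t y" using fixed_inv[OF pG y py] pt by simp
    finally have "\<phi> (v [^] k) (\<phi> (t \<otimes> m n) x) = \<phi> (t \<otimes> m n) x"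
      using commutator_pow[OF pG up, of k] u(2)[OF p] mult[OF tG mG x] by (simp add: t_def y_def)
    \<comment> \<open>Commutativity of \<open>M\<close> carries the fixed point back from the
      translate to \<open>x\<close>.\<close>
    moreover have "v [^] k \<otimes> (t \<otimes> m n) = (t \<otimes> m n) \<otimes> v [^] k"
      using comm v t m by simp
    ultimately have "\<phi> (t \<otimes> m n) (\<phi> (v [^] k) x) = \<phi> (t \<otimes> m n) x"
      using mult[of "v [^] k" "t \<otimes> m n" x] mult[of "t \<otimes> m n" "v [^] k" x] tG mG v(1) x by simp
    then have "\<phi> (v [^] k) x = x"
      using inj_prop[of "t \<otimes> m n"] tG mG v(1) x img[of "v [^] k" x] by (auto dest: inj_onD)
    then have "\<phi> ((v [^] k) [^] (fact (card P) div k :: nat)) x = x"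
      using v x by (intro fixed_pow[of "v [^] k"]) auto
    moreover have "k dvd fact (card P)" using k by (intro dvd_fact) auto
    ultimately show ?thesis using v by (simp add: nat_pow_pow)
  qed
  then have "v [^] (fact (card P) :: nat) = \<one>" using v by (intro eq_one_if_fixes_all) auto
  then show False using R(2)[OF v, of "fact (card P)"] R(3) by simp
qed

section \<open>Word length\<close>

lemma (in group) foldr_mult_append:
  assumes "us \<in> lists (carrier G)" "vs \<in> lists (carrier G)"
  shows "foldr (\<otimes>) (us @ vs) \<one> = foldr (\<otimes>) us \<one> \<otimes> foldr (\<otimes>) vs \<one>"
    and "foldr (\<otimes>) us \<one> \<in> carrier G"
proof -
  have closed: "foldr (\<otimes>) ws \<one> \<in> carrier G" if "ws \<in> lists (carrier G)" for ws
    using that by (induction ws) auto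
  show "foldr (\<otimes>) us \<one> \<in> carrier G" using assms closed by blast
  show "foldr (\<otimes>) (us @ vs) \<one> = foldr (\<otimes>) us \<one> \<otimes> foldr (\<otimes>) vs \<one>"
    using assms(1) by (induction us) (auto simp: closed assms(2) m_assoc simp del: in_lists_conv_set)
qed

lemma (in group) generated_word:
  assumes "finite_symmetric_generating_set G S" "g \<in> carrier G"
  shows "\<exists>ws \<in> lists S. foldr (\<otimes>) ws \<one> = g"
proof -
  have S: "S \<subseteq> carrier G" "\<And>s. s \<in> S \<Longrightarrow> inv s \<in> S" "g \<in> generate G S"
    using assms by (auto simp: finite_symmetric_generating_set_def)
  show ?thesis
    using S(3)
  proof induction
    case one
    show ?case by (intro bexI[of _ "[]"]) auto
  next
    case (incl s)
    then show ?case using S(1) by (intro bexI[of _ "[s]"]) auto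
  next
    case (inv s)
    then show ?case using S(1,2) by (intro bexI[of _ "[inv s]"]) auto
  next
    case (eng g k)
    then obtain us vs where "us \<in> lists S" "vs \<in> lists S" "foldr (\<otimes>) us \<one> = g" "foldr (\<otimes>) vs \<one> = k"
      by blast
    moreover have "lists S \<subseteq> lists (carrier G)" using S(1) by (rule lists_mono)
    ultimately have "foldr (\<otimes>) (us @ vs) \<one> = g \<otimes> k"
      using foldr_mult_append(1)[of us vs] by blast
    then show ?case
      using \<open>us \<in> lists S\<close> \<open>vs \<in> lists S\<close> by (intro bexI[of _ "us @ vs"]) auto
  qed
qed

lemma word_length_le:
  assumes "ws \<in> lists S" "foldr (\<otimes>\<^bsub>G\<^esub>) ws \<one>\<^bsub>G\<^esub> = g"
  shows "word_length G S g \<le> length ws"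
  unfolding word_length_def using assms by (intro Least_le) auto

lemma (in group) word_length_attained:
  assumes "finite_symmetric_generating_set G S" "g \<in> carrier G"
  shows "\<exists>ws \<in> lists S. length ws = word_length G S g \<and> foldr (\<otimes>) ws \<one> = g"
proof -
  let ?P = "\<lambda>n. \<exists>ws \<in> lists S. length ws = n \<and> foldr (\<otimes>) ws \<one> = g"
  have "\<exists>n. ?P n" using generated_word[OF assms] by blast
  then have "?P (LEAST n. ?P n)" by (rule LeastI_ex)
  then show ?thesis unfolding word_length_def .
qed

lemma (in group) word_length_mult:
  assumes S: "finite_symmetric_generating_set G S" and gh: "g \<in> carrier G" "h \<in> carrier G"
  shows "word_length G S (g \<otimes> h) \<le> word_length G S g + word_length G S h"
proof -
  obtain us vs where us: "us \<in> lists S" "length us = word_length G S g" "foldr (\<otimes>) us \<one> = g"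
    and vs: "vs \<in> lists S" "length vs = word_length G S h" "foldr (\<otimes>) vs \<one> = h"
    using word_length_attained[OF S] gh by metis
  have "lists S \<subseteq> lists (carrier G)"
    using S by (intro lists_mono) (auto simp: finite_symmetric_generating_set_def)
  then have "foldr (\<otimes>) (us @ vs) \<one> = g \<otimes> h"
    using foldr_mult_append(1)[of us vs] us vs by blast
  then show ?thesis using word_length_le[of "us @ vs" S] us vs by fastforce
qed

text \<open>Each factor is \<open>x \<otimes> u\<close> or \<open>x\<close>, and the sum of their
  lengths bounds both cases.\<close>

lemma (in group) word_length_branch:
  assumes S: "finite_symmetric_generating_set G S" and ux: "u \<in> carrier G" "x \<in> carrier G"
  shows "word_length G S (branch G u x bs) \<le> (word_length G S (x \<otimes> u) + word_length G S x) * length bs"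
proof (induction bs)
  case Nil
  show ?case using word_length_le[of "[]" S G \<one>] by simp
next
  case (Cons b bs)
  have "word_length G S (branch G u x (b # bs)) \<le>
      word_length G S (branch G u x bs) + word_length G S (x \<otimes> (if b then u else \<one>))"
    using ux word_length_mult[OF S, of "branch G u x bs" "x \<otimes> (if b then u else \<one>)"] by simp
  moreover have "word_length G S (x \<otimes> (if b then u else \<one>)) \<le> word_length G S (x \<otimes> u) + word_length G S x"
    using ux by simp
  ultimately show ?case using Cons by simp
qed

lemma (in group_action) card_le_action_growth:
  assumes S: "finite_symmetric_generating_set G S" and x: "x \<in> E"
    and A: "A \<subseteq> carrier G" "\<And>g. g \<in> A \<Longrightarrow> word_length G S g \<le> n"
  shows "card ((\<lambda>g. \<phi> g x) ` A) \<le> action_growth G S E \<phi> n"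
proof -
  interpret group G using group_hom group_hom.axioms(1) by auto
  let ?B = "{g \<in> carrier G. word_length G S g \<le> n}"
  have "?B \<subseteq> (\<lambda>ws. foldr (\<otimes>) ws \<one>) ` {ws. set ws \<subseteq> S \<and> length ws \<le> n}"
  proof
    fix g assume "g \<in> ?B"
    then obtain ws where "ws \<in> lists S" "length ws \<le> n" "foldr (\<otimes>) ws \<one> = g"
      using word_length_attained[OF S, of g] by (metis (mono_tags, lifting) mem_Collect_eq)
    then show "g \<in> (\<lambda>ws. foldr (\<otimes>) ws \<one>) ` {ws. set ws \<subseteq> S \<and> length ws \<le> n}"
      by (auto simp: lists_eq_set)
  qed
  then have B: "finite ?B"
    using S finite_lists_length_le[of S n]
    by (meson finite_imageI finite_subset finite_symmetric_generating_set_def)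
  have eq: "{\<phi> g y |g. g \<in> carrier G \<and> word_length G S g \<le> n} = (\<lambda>g. \<phi> g y) ` ?B" for y by blast
  have "card ((\<lambda>g. \<phi> g x) ` A) \<le> card ((\<lambda>g. \<phi> g x) ` ?B)"
    using A B by (intro card_mono) auto
  also have "\<dots> \<le> action_growth G S E \<phi> n"
  proof -
    \<comment> \<open>\<open>E\<close> may be infinite, but all counts are bounded by the size of
      the ball, so the maximum is over a finite set of numbers.\<close>
    have "(\<lambda>y. card ((\<lambda>g. \<phi> g y) ` ?B)) ` E \<subseteq> {..card ?B}" using card_image_le[OF B] by auto
    then have "finite ((\<lambda>y. card ((\<lambda>g. \<phi> g y) ` ?B)) ` E)" using finite_subset by blast
    then show ?thesis unfolding action_growth_def eq using x by (intro Max_ge) auto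
  qed
  finally show ?thesis .
qed

section \<open>Free solvable groups\<close>

text \<open>The pair \<open>u\<close>, \<open>x\<close> is fixed before the action and
  \<open>n\<close>, so the lengths of the separated elements grow only linearly in
  \<open>n\<close>.\<close>

lemma free_solvable_group_moved_point:
  fixes d l :: nat and E :: "'x set"
  assumes d: "d \<ge> 2" and l: "l \<ge> 3"
  shows "\<exists>u \<in> carrier (free_solvable_group d l). \<exists>x \<in> carrier (free_solvable_group d l).
    \<forall>(E :: 'x set) act n. faithful_action (free_solvable_group d l) E act \<longrightarrow>
      (\<exists>e\<in>E. inj_on (\<lambda>bs. act (branch (free_solvable_group d l) u x bs) e) {bs. length bs = n})"
proof -
  define F where "F = free_group {..<d}"
  interpret F: group F unfolding F_def by (rule group_free_group)
  define K where "K = (derived F ^^ (l - 2)) (carrier F)"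
  define N where "N = derived F K"
  define L where "L = derived F N"
  define G where "G = free_solvable_group d l"
  have "l = Suc (Suc (l - 2))" using l by simp
  then have "L = (derived F ^^ l) (carrier F)"
    unfolding L_def N_def K_def by (metis comp_apply funpow.simps(2))
  then have G: "G = F Mod L" by (simp add: G_def free_solvable_group_def F_def Let_def)
  have normal: "K \<lhd> F" "N \<lhd> F" "L \<lhd> F"
    unfolding L_def N_def K_def
    by (auto intro!: F.derived_is_normal exp_of_derived_normal F.is_group)
  interpret K: free_group_normal K F "{..<d}"
    using normal by (simp add: free_group_normal_def free_group_normal_axioms_def F_def)
  interpret N: free_group_normal N F "{..<d}"
    using normal by (simp add: free_group_normal_def free_group_normal_axioms_def F_def)
  interpret C: free_group_normal "carrier F" F "{..<d}"
    using F.normal_self by (simp add: free_group_normal_def free_group_normal_axioms_def F_def)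
  interpret L: normal L F by (rule normal)
  define h where "h = (\<lambda>w. L #>\<^bsub>F\<^esub> w)"
  interpret h: group_hom F G h
    unfolding group_hom_def group_hom_axioms_def h_def G
    using L.r_coset_hom_Mod L.factorgroup_is_group F.is_group by blast
  have h_surj: "h ` carrier F = carrier G" by (simp add: G h_def carrier_FactGroup)
  have h_one: "h w = \<one>\<^bsub>G\<^esub> \<longleftrightarrow> w \<in> L" if "w \<in> carrier F" for w
  proof -
    have "L #>\<^bsub>F\<^esub> w = L \<longleftrightarrow> w \<in> L"
      using that F.coset_join1 F.coset_join2 L.is_subgroup L.subset by metis
    then show ?thesis by (simp add: h_def G)
  qed

  define x where "x = [(0 :: nat, True)]"
  have x: "x \<in> carrier F" using d by (simp add: x_def F_def)
  \<comment> \<open>Modulo the whole group every edge is a loop and the flow is an exponent sum; it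
    detects \<open>x\<close> modulo the first derived subgroup.\<close>
  have x_pow: "x [^]\<^bsub>F\<^esub> k \<notin> K" if "k > 0" for k :: nat
  proof -
    have "flow (carrier F) (0, True) x \<one>\<^bsub>F\<^esub> \<noteq> 0"
      using d letter_inv_neq[of "(0 :: nat, True)", symmetric] unfolding x_def by (simp add: C.flow_Cons)
    then have "x [^]\<^bsub>F\<^esub> k \<notin> derived F (carrier F)"
      using C.pow_notin_derived[of "(0, True)" x "\<one>\<^bsub>F\<^esub>" k] x d that by auto
    moreover have "K \<subseteq> derived F (carrier F)"
    proof -
      \<comment> \<open>Here \<open>l \<ge> 3\<close> enters: \<open>K\<close> is the first derived
        subgroup or a later one.\<close>
      have "l - 2 = Suc (l - 3)" using l by simp
      then show ?thesis unfolding K_def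
        by (simp add: F.mono_derived F.exp_of_derived_in_carrier)
    qed
    ultimately show ?thesis by blast
  qed
  have nontrivial: "(derived F ^^ k) (carrier F) \<noteq> {\<one>\<^bsub>F\<^esub>}" for k
    using free_group_derived_nontrivial[of 0 "{..<d}" 1 k] d by (simp add: F_def)
  have "K \<noteq> {\<one>\<^bsub>F\<^esub>}" using nontrivial by (simp add: K_def)
  then obtain a u where a: "fst a \<in> {..<d}" and u: "u \<in> K" "flow K a u \<one>\<^bsub>F\<^esub> \<noteq> 0"
    using K.exists_flow_nonzero by blast
  have "N \<noteq> {\<one>\<^bsub>F\<^esub>}" using nontrivial[of "Suc (l - 2)"] by (simp add: K_def N_def)
  then obtain c w where c: "fst c \<in> {..<d}" and w: "w \<in> N" "flow N c w \<one>\<^bsub>F\<^esub> \<noteq> 0"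
    using N.exists_flow_nonzero by blast
  have uF: "u \<in> carrier F" using u(1) by (rule K.mem_carrier)

  have "N \<subseteq> carrier F" by (rule N.subset)
  have M: "abelian_normal (h ` N) G"
  proof (intro abelian_normal.intro abelian_normal_axioms.intro)
    show "h ` N \<lhd> G" using N.surj_hom_normal_subgroup[OF h.group_hom_axioms h_surj] .
    fix p q assume "p \<in> h ` N" "q \<in> h ` N"
    then obtain p' q' where pq: "p' \<in> N" "q' \<in> N" "p = h p'" "q = h q'" by blast
    then have "commutator F p' q' \<in> L"
      unfolding commutator_def L_def derived_def by (intro generate.incl) auto
    then have "h (commutator F p' q') = \<one>\<^bsub>G\<^esub>" using h_one pq by simp
    then show "p \<otimes>\<^bsub>G\<^esub> q = q \<otimes>\<^bsub>G\<^esub> p"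
      using pq h.hom_commutator[of p' q'] h.H.commutator_eq_one_iff[of p q] by simp
  qed
  have "\<exists>e\<in>E. inj_on (\<lambda>bs. act (branch G (h u) (h x) bs) e) {bs. length bs = n}"
    if "faithful_action G E act" for E :: "'x set" and act n
  proof -
    interpret act: faithful_action G E act by fact
    let ?B = "{bs :: bool list. length bs = n}"
    define q where "q = (\<lambda>(bs, bs'). inv\<^bsub>F\<^esub> branch F u x bs \<otimes>\<^bsub>F\<^esub> branch F u x bs')"
    define Q where "Q = q ` {(bs, bs') \<in> ?B \<times> ?B. bs \<noteq> bs'}"
    have "finite ?B" using finite_lists_length_eq[of "UNIV :: bool set" n] by simp
    then have "finite (q ` (?B \<times> ?B))" by simp
    moreover have "Q \<subseteq> q ` (?B \<times> ?B)" by (auto simp: Q_def)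
    ultimately have "finite Q" by (rule rev_finite_subset)
    have QK: "Q \<subseteq> K" using K.branch_quotient_mem u x by (auto simp: Q_def q_def)
    then have QF: "Q \<subseteq> carrier F" using K.subset by blast
    \<comment> \<open>Quotients of different branches have nonzero flow over \<open>K\<close>, hence
      infinite order modulo \<open>N\<close>, the derived subgroup of \<open>K\<close>.\<close>
    have Q_pow: "p [^]\<^bsub>F\<^esub> k \<notin> N" if "p \<in> Q" "k > 0" for p and k :: nat
    proof -
      obtain bs bs' where bs: "length bs = n" "length bs' = n" "bs \<noteq> bs'" "p = q (bs, bs')"
        using \<open>p \<in> Q\<close> by (auto simp: Q_def)
      then obtain g where "g \<in> carrier F" "flow K a p g \<noteq> 0"
        using K.flow_branch_quotient[of x u a "\<one>\<^bsub>F\<^esub>" bs bs'] x x_pow u a by (auto simp: q_def)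
      then show ?thesis unfolding N_def
        using K.pow_notin_derived[of a p g k] a QK that by auto
    qed
    define R where "R = (\<lambda>v. \<exists>w\<in>N. v = h w \<and> (\<exists>g\<in>carrier F. flow N c w g \<noteq> 0))"
    have "\<exists>e\<in>E. \<forall>p\<in>h ` Q. act p e \<noteq> e"
    proof (rule act.exists_point_moved[where M = "h ` N" and R = R and w = "h w"])
      show "finite (h ` Q)" "h ` Q \<subseteq> carrier G" using \<open>finite Q\<close> QF by auto
      show "h w \<in> h ` N" "R (h w)" using w by (auto simp: R_def)
      show "\<not> R \<one>\<^bsub>G\<^esub>"
      proof
        assume "R \<one>\<^bsub>G\<^esub>"
        then obtain w g where "w \<in> N" "h w = \<one>\<^bsub>G\<^esub>" "g \<in> carrier F" "flow N c w g \<noteq> 0"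
          by (auto simp: R_def)
        then show False using h_one[of w] N.flow_derived[of c w g] c by (auto simp: L_def)
      qed
    next
      fix p r assume "p \<in> h ` Q" "r \<in> h ` Q"
      then obtain p' r' where "p' \<in> Q" "r' \<in> Q" "p = h p'" "r = h r'" by blast
      \<comment> \<open>\<open>Q\<close> lies in \<open>K\<close>, whose commutators lie in
        \<open>N\<close>.\<close>
      moreover from this have "commutator F p' r' \<in> N"
        unfolding commutator_def N_def derived_def using QK by (intro generate.incl) auto
      ultimately show "commutator G p r \<in> h ` N"
        using h.hom_commutator[of p' r'] QF by (metis image_eqI subsetD)
    next
      fix p v assume p: "p \<in> h ` Q" and "R v"
      obtain p' where p': "p' \<in> Q" "p = h p'" using p by blast
      obtain w g where w: "w \<in> N" "v = h w" "g \<in> carrier F" "flow N c w g \<noteq> 0"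
        using \<open>R v\<close> by (auto simp: R_def)
      have p'F: "p' \<in> carrier F" using p' QF by blast
      have "\<exists>g \<in> carrier F. flow N c (commutator F p' w) g \<noteq> 0"
        unfolding commutator_def
        using c p'F Q_pow[OF p'(1)] w(1,3,4) by (rule N.flow_commutator_nonzero)
      moreover have "commutator F p' w \<in> N"
        using N.inv_op_closed2[OF p'F w(1)] w(1) by (simp add: commutator_def)
      moreover have "commutator G p v = h (commutator F p' w)"
        using h.hom_commutator[of p' w] p'F p' w by simp
      ultimately show "R (commutator G p v)" by (auto simp: R_def)
    next
      fix v and k :: nat assume "R v" "k > 0"
      obtain w g where w: "w \<in> N" "v = h w" "g \<in> carrier F" "flow N c w g \<noteq> 0"
        using \<open>R v\<close> by (auto simp: R_def)
      have "v [^]\<^bsub>G\<^esub> k = h (w [^]\<^bsub>F\<^esub> k)" using w by (simp add: h.hom_nat_pow)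
      moreover have "flow N c (w [^]\<^bsub>F\<^esub> k) g \<noteq> 0" using N.flow_pow[of c w g k] w c \<open>k > 0\<close> by simp
      moreover have "w [^]\<^bsub>F\<^esub> k \<in> N" using w(1) by (induction k) auto
      ultimately show "R (v [^]\<^bsub>G\<^esub> k)" using w(3) by (auto simp: R_def)
    qed (rule M)
    then obtain e where e: "e \<in> E" "\<And>p. p \<in> Q \<Longrightarrow> act (h p) e \<noteq> e" by blast
    have "inj_on (\<lambda>bs. act (branch G (h u) (h x) bs) e) ?B"
    proof (rule inj_onI, rule ccontr)
      fix bs bs' assume bs: "bs \<in> ?B" "bs' \<in> ?B" "bs \<noteq> bs'"
        and eq: "act (branch G (h u) (h x) bs) e = act (branch G (h u) (h x) bs') e"
      let ?s = "branch F u x bs" and ?t = "branch F u x bs'"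
      have closed: "?s \<in> carrier F" "?t \<in> carrier F" using uF x by auto
      have "act (h (q (bs, bs'))) e = act (inv\<^bsub>G\<^esub> h ?s) (act (h ?t) e)"
        using closed act.composition_rule[of e "inv\<^bsub>G\<^esub> h ?s" "h ?t"] e(1) by (simp add: q_def)
      also have "act (h ?t) e = act (h ?s) e" using eq h.hom_branch[OF uF x] by simp
      also have "act (inv\<^bsub>G\<^esub> h ?s) (act (h ?s) e) = e"
        using act.orbit_sym_aux[of "h ?s" e] closed e(1) by simp
      finally show False using e(2)[of "q (bs, bs')"] bs by (auto simp: Q_def)
    qed
    then show ?thesis using e(1) by blast
  qed
  then show ?thesis using uF x h.hom_closed unfolding G_def[symmetric] by blast
qed

theorem theorem7p22:
  fixes d l :: nat
  assumes "d \<ge> 2" and "l \<ge> 3"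
  shows "schreier_growth_gap TYPE('x) (free_solvable_group d l) (\<lambda>n. exp (real n))"
proof -
  let ?G = "free_solvable_group d l"
  interpret G: group ?G by (rule group_free_solvable_group)
  obtain u x where ux: "u \<in> carrier ?G" "x \<in> carrier ?G"
    and inj: "\<And>(E :: 'x set) act n. faithful_action ?G E act \<Longrightarrow>
      \<exists>e\<in>E. inj_on (\<lambda>bs. act (branch ?G u x bs) e) {bs. length bs = n}"
    using free_solvable_group_moved_point[OF assms, where 'x = 'x] by blast
  have "(\<lambda>n. exp (real n)) \<preceq>\<^sub>g (\<lambda>n. real (action_growth ?G S E act n))"
    if S: "finite_symmetric_generating_set ?G S" and act: "faithful_action ?G E act"
    for S and E :: "'x set" and act
  proof -
    interpret act: faithful_action ?G E act by fact
    define c where "c = Suc (word_length ?G S (x \<otimes>\<^bsub>?G\<^esub> u) + word_length ?G S x)"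
    have growth: "2 ^ n \<le> action_growth ?G S E act (c * n)" for n
    proof -
      let ?B = "{bs :: bool list. length bs = n}"
      obtain e where e: "e \<in> E" "inj_on (\<lambda>bs. act (branch ?G u x bs) e) ?B"
        using inj[OF act] by blast
      have "word_length ?G S (branch ?G u x bs) \<le> c * n" if "length bs = n" for bs
        using G.word_length_branch[OF S ux, of bs] that by (simp add: c_def)
      then have "card ((\<lambda>g. act g e) ` branch ?G u x ` ?B) \<le> action_growth ?G S E act (c * n)"
        using S e(1) ux by (intro act.card_le_action_growth) auto
      moreover have "card ((\<lambda>g. act g e) ` branch ?G u x ` ?B) = card ?B"
        using card_image[OF e(2)] by (simp add: image_image)
      moreover have "card ?B = 2 ^ n"
        using card_lists_length_eq[of "UNIV :: bool set" n] by simp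
      ultimately show ?thesis by simp
    qed
    \<comment> \<open>Since \<open>exp 1\<close> is below 4, the \<open>2 ^ (2 * n)\<close> branches
      of length \<open>2 * n\<close> suffice, which gives the constant \<open>2 * c\<close>.\<close>
    have "exp (real n) \<le> real (2 * c) * real (action_growth ?G S E act (2 * c * n))" for n
    proof -
      have "exp (real n) = exp 1 ^ n" by (simp flip: exp_of_nat_mult)
      also have "\<dots> \<le> 4 ^ n" using exp_le by (intro power_mono) auto
      also have "(4 :: real) ^ n = real (2 ^ (2 * n))" by (simp add: power_mult)
      also have "\<dots> \<le> real (action_growth ?G S E act (2 * c * n))"
        using growth[of "2 * n"] by (simp add: mult_ac del: of_nat_power)
      also have "\<dots> \<le> real (2 * c) * real (action_growth ?G S E act (2 * c * n))"
        by (simp add: c_def mult_le_cancel_right1)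
      finally show ?thesis .
    qed
    then show ?thesis
      unfolding growth_le_def by (intro exI[of _ "2 * c"]) (simp add: c_def)
  qed
  then show ?thesis
    unfolding schreier_growth_gap_def
    using G.is_group finite_symmetric_generating_set_free_solvable_group by blast
qed

end
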